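(* Let $\{(X_i,x_i)\}_{i\in\mathbb{N}}$ be a family of pointed spaces, each locally strongly contractible at $x_i$ and first countable at $x_i$, and let $X=\widetilde{\bigvee}_{i\in\mathbb{N}}(X_i,x_i)$ be their weak join with common point $x_\ast$. Then $\mathcal{H}_\infty(X,x_\ast)$ can be embedded (as a group) in $\prod_{n\in\mathbb{N}}\prod_{k\in\mathbb{N}}\pi_n(X,x_\ast)$.
   Context: A pointed space $(Y,y_0)$ is locally strongly contractible at $y_0$ if for every neighborhood $U$ of $y_0$ there is a neighborhood $V\subseteq U$ of $y_0$ such that the inclusion $V\hookrightarrow U$ is homotopic in $U$ to the constant map at $y_0$ relative to $\{y_0\}$. The weak join $\widetilde{\bigvee}_{i\in\mathbb{N}}(Y_i,y_i)$ of pointed spaces is the set obtained from their disjoint union by identifying all base points to one point, with the topology in which $U$ is open iff $U\cap Y_i$ is open in $Y_i$ for all $i$ and, if $U$ contains the common point, $Y_i\subseteq U$ for all but finitely many $i$. For $n\geq1$, $\mathbb{H}^n=\{(r_0,\dots,r_n)\in\mathbb{R}^{n+1} : (r_0-1/k)^2+\sum_{i=1}^n r_i^2=(1/k)^2 \text{ for some } k\in\mathbb{N}\}$ is the $n$-dimensional Hawaiian earring with base point $\theta$ (the origin); $S^n_k$ is its sphere of radius $1/k$. $\mathbb{H}^\infty$ is the weak join of $\{(\mathbb{H}^n,\theta)\}_{n\in\mathbb{N}}$. $\mathcal{H}_\infty(X,x_\ast)$ is the set of pointed homotopy classes (rel $\{\theta\}$) of continuous maps $(\mathbb{H}^\infty,\theta)\to(X,x_\ast)$,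 with group operation $[f][g]=[f\ast g]$ where on each sphere $S^n_k\subseteq\mathbb{H}^n$, $(f\ast g)|_{S^n_k}$ is the usual $\pi_n$-concatenation of $f|_{S^n_k}$ and $g|_{S^n_k}$. *)

theory Defs
  imports "HOL-Analysis.Analysis" "HOL-Algebra.Product_Groups"
begin

definition is_nbhd :: "'a topology \<Rightarrow> 'a \<Rightarrow> 'a set \<Rightarrow> bool" where
  "is_nbhd X y U \<longleftrightarrow> U \<subseteq> topspace X \<and> (\<exists>W. openin X W \<and> y \<in> W \<and> W \<subseteq> U)"

definition loc_strong_contractible_at :: "'a topology \<Rightarrow> 'a \<Rightarrow> bool" where
  "loc_strong_contractible_at X y \<longleftrightarrow>
     (\<forall>U. is_nbhd X y U \<longrightarrow>
        (\<exists>V. is_nbhd X y V \<and> V \<subseteq> U \<and>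
             homotopic_with (\<lambda>h. h y = y) (subtopology X V) (subtopology X U) id (\<lambda>_. y)))"

definition first_countable_at :: "'a topology \<Rightarrow> 'a \<Rightarrow> bool" where
  "first_countable_at X y \<longleftrightarrow>
     (\<exists>\<B>. countable \<B> \<and> (\<forall>V\<in>\<B>. openin X V \<and> y \<in> V) \<and>
          (\<forall>U. openin X U \<and> y \<in> U \<longrightarrow> (\<exists>V\<in>\<B>. V \<subseteq> U)))"

text \<open>Points: None is the common base point; Some (i, y) is a non-base point y of X i.\<close>
definition wj_inj :: "(nat \<Rightarrow> 'a) \<Rightarrow> nat \<Rightarrow> 'a \<Rightarrow> (nat \<times> 'a) option" where
  "wj_inj x i y = (if y = x i then None else Some (i, y))"

definition wj_carrier :: "(nat \<Rightarrow> 'a topology) \<Rightarrow> (nat \<Rightarrow> 'a) \<Rightarrow> (nat \<times> 'a) option set" where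
  "wj_carrier X x = insert None {Some (i, y) | i y. y \<in> topspace (X i) \<and> y \<noteq> x i}"

definition wj_open :: "(nat \<Rightarrow> 'a topology) \<Rightarrow> (nat \<Rightarrow> 'a) \<Rightarrow> (nat \<times> 'a) option set \<Rightarrow> bool" where
  "wj_open X x U \<longleftrightarrow> U \<subseteq> wj_carrier X x \<and>
     (\<forall>i. openin (X i) {y \<in> topspace (X i). wj_inj x i y \<in> U}) \<and>
     (None \<in> U \<longrightarrow> finite {i. \<not> (wj_inj x i ` topspace (X i) \<subseteq> U)})"

lemma istopology_wj_open: "istopology (wj_open X x)"
  unfolding istopology_def
proof (intro conjI allI impI)
  fix S T assume S: "wj_open X x S" and T: "wj_open X x T"
  have "{y \<in> topspace (X i). wj_inj x i y \<in> S \<inter> T} =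
        {y \<in> topspace (X i). wj_inj x i y \<in> S} \<inter> {y \<in> topspace (X i). wj_inj x i y \<in> T}" for i
    by auto
  moreover have "{i. \<not> (wj_inj x i ` topspace (X i) \<subseteq> S \<inter> T)} \<subseteq>
      {i. \<not> (wj_inj x i ` topspace (X i) \<subseteq> S)} \<union> {i. \<not> (wj_inj x i ` topspace (X i) \<subseteq> T)}"
    by auto
  ultimately show "wj_open X x (S \<inter> T)"
    using S T unfolding wj_open_def
    by (auto intro: openin_Int finite_subset)
next
  fix K assume K: "\<forall>U\<in>K. wj_open X x U"
  have pre: "{y \<in> topspace (X i). wj_inj x i y \<in> \<Union>K} =
        (\<Union>U\<in>K. {y \<in> topspace (X i). wj_inj x i y \<in> U})" for i
    by auto
  have op: "openin (X i) {y \<in> topspace (X i). wj_inj x i y \<in> \<Union>K}" for i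
    unfolding pre using K unfolding wj_open_def by (intro openin_Union) auto
  have fin: "finite {i. \<not> (wj_inj x i ` topspace (X i) \<subseteq> \<Union>K)}" if N: "None \<in> \<Union>K"
  proof -
    obtain U where U: "U \<in> K" "None \<in> U" using N by auto
    have "{i. \<not> (wj_inj x i ` topspace (X i) \<subseteq> \<Union>K)} \<subseteq> {i. \<not> (wj_inj x i ` topspace (X i) \<subseteq> U)}"
      using U by auto
    moreover have "finite {i. \<not> (wj_inj x i ` topspace (X i) \<subseteq> U)}"
      using K U unfolding wj_open_def by auto
    ultimately show ?thesis by (rule finite_subset)
  qed
  show "wj_open X x (\<Union>K)"
    using K op fin unfolding wj_open_def by auto
qed

definition weak_join :: "(nat \<Rightarrow> 'a topology) \<Rightarrow> (nat \<Rightarrow> 'a) \<Rightarrow> (nat \<times> 'a) option topology" where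
  "weak_join X x = topology (wj_open X x)"

text \<open>Points of R^(n+1) are functions r :: nat => real with r i = 0 for i > n
  (the topology Euclidean_space (Suc n)).\<close>
definition theta :: "nat \<Rightarrow> real" where "theta = (\<lambda>_. 0)"

definition hsphere :: "nat \<Rightarrow> nat \<Rightarrow> (nat \<Rightarrow> real) set" where
  "hsphere n k = {r. (\<forall>i>n. r i = 0) \<and>
      (r 0 - 1 / real k)^2 + (\<Sum>i\<in>{1..n}. (r i)^2) = (1 / real k)^2}"

definition hawaiian :: "nat \<Rightarrow> (nat \<Rightarrow> real) topology" where
  "hawaiian n = subtopology (Euclidean_space (Suc n)) (\<Union>k\<in>{1..}. hsphere n k)"

text \<open>H^infinity: weak join of (H^n, theta), n = 1, 2, ...; index i stands for n = i + 1.\<close>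
definition hinf :: "(nat \<times> (nat \<Rightarrow> real)) option topology" where
  "hinf = weak_join (\<lambda>i. hawaiian (Suc i)) (\<lambda>_. theta)"

definition icube :: "nat \<Rightarrow> (nat \<Rightarrow> real) set" where
  "icube n = {t. (\<forall>i<n. 0 \<le> t i \<and> t i \<le> 1) \<and> (\<forall>i\<ge>n. t i = 0)}"

definition cube_boundary :: "nat \<Rightarrow> (nat \<Rightarrow> real) set" where
  "cube_boundary n = {t \<in> icube n. \<exists>i<n. t i = 0 \<or> t i = 1}"

definition cube_top :: "nat \<Rightarrow> (nat \<Rightarrow> real) topology" where
  "cube_top n = subtopology (Euclidean_space n) (icube n)"

definition cube_concat :: "((nat \<Rightarrow> real) \<Rightarrow> 'b) \<Rightarrow> ((nat \<Rightarrow> real) \<Rightarrow> 'b) \<Rightarrow> (nat \<Rightarrow> real) \<Rightarrow> 'b" where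
  "cube_concat f g = (\<lambda>t. if t 0 \<le> 1/2 then f (t(0 := 2 * t 0)) else g (t(0 := 2 * t 0 - 1)))"

definition pi_class :: "nat \<Rightarrow> 'b topology \<Rightarrow> 'b \<Rightarrow> ((nat \<Rightarrow> real) \<Rightarrow> 'b) \<Rightarrow> ((nat \<Rightarrow> real) \<Rightarrow> 'b) set" where
  "pi_class n Y y f = {g. homotopic_with (\<lambda>h. \<forall>t\<in>cube_boundary n. h t = y) (cube_top n) Y f g}"

definition pi_group :: "nat \<Rightarrow> 'b topology \<Rightarrow> 'b \<Rightarrow> ((nat \<Rightarrow> real) \<Rightarrow> 'b) set monoid" where
  "pi_group n Y y =
     \<lparr>carrier = pi_class n Y y ` {f. continuous_map (cube_top n) Y f \<and> (\<forall>t\<in>cube_boundary n. f t = y)},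
      monoid.mult = (\<lambda>A B. pi_class n Y y (cube_concat (SOME f. f \<in> A) (SOME g. g \<in> B))),
      one = pi_class n Y y (\<lambda>_. y)\<rparr>"

text \<open>A fixed relative homeomorphism (I^n, boundary) -> (S^n_k, theta): the open cube is mapped onto
  R^n coordinatewise by t |-> ln (t/(1-t)), then R^n (as the hyperplane r_0 = k/2) is mapped onto
  S^n_k minus theta by the inversion r |-> r/|r|^2; the boundary goes to theta.\<close>
definition cube_to_sphere :: "nat \<Rightarrow> nat \<Rightarrow> (nat \<Rightarrow> real) \<Rightarrow> (nat \<Rightarrow> real)" where
  "cube_to_sphere n k t =
     (if (\<forall>i<n. 0 < t i \<and> t i < 1) then
        (let \<psi> = (\<lambda>i. ln (t i / (1 - t i)));
             D = (real k)^2 / 4 + (\<Sum>i<n. (\<psi> i)^2)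
         in (\<lambda>j. if j = 0 then (real k / 2) / D else if j \<le> n then \<psi> (j - 1) / D else 0))
      else theta)"

text \<open>Its inverse on S^n_k minus theta.\<close>
definition sphere_to_cube :: "nat \<Rightarrow> (nat \<Rightarrow> real) \<Rightarrow> (nat \<Rightarrow> real)" where
  "sphere_to_cube n p =
     (let N = (\<Sum>j\<le>n. (p j)^2) in (\<lambda>i. if i < n then 1 / (1 + exp (- (p (Suc i) / N))) else 0))"

definition sphere_concat :: "nat \<Rightarrow> nat \<Rightarrow> ((nat \<Rightarrow> real) \<Rightarrow> 'b) \<Rightarrow> ((nat \<Rightarrow> real) \<Rightarrow> 'b) \<Rightarrow> (nat \<Rightarrow> real) \<Rightarrow> 'b" where
  "sphere_concat n k f g p =
     (let t = sphere_to_cube n p in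
        if t 0 \<le> 1/2 then f (cube_to_sphere n k (t(0 := 2 * t 0)))
        else g (cube_to_sphere n k (t(0 := 2 * t 0 - 1))))"

definition hinf_concat ::
  "((nat \<times> (nat \<Rightarrow> real)) option \<Rightarrow> 'b) \<Rightarrow> ((nat \<times> (nat \<Rightarrow> real)) option \<Rightarrow> 'b) \<Rightarrow>
   (nat \<times> (nat \<Rightarrow> real)) option \<Rightarrow> 'b" where
  "hinf_concat f g q =
     (case q of
        None \<Rightarrow> f None
      | Some (i, p) \<Rightarrow>
          (let n = Suc i;
               k = (SOME k. 1 \<le> k \<and> p \<in> hsphere n k);
               emb = wj_inj (\<lambda>_. theta) i
           in sphere_concat n k (f \<circ> emb) (g \<circ> emb) p))"

definition hinf_class :: "'b topology \<Rightarrow> 'b \<Rightarrow> ((nat \<times> (nat \<Rightarrow> real)) option \<Rightarrow> 'b) \<Rightarrow>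
    ((nat \<times> (nat \<Rightarrow> real)) option \<Rightarrow> 'b) set" where
  "hinf_class Y y f = {g. homotopic_with (\<lambda>h. h None = y) hinf Y f g}"

definition Hinf_group :: "'b topology \<Rightarrow> 'b \<Rightarrow> ((nat \<times> (nat \<Rightarrow> real)) option \<Rightarrow> 'b) set monoid" where
  "Hinf_group Y y =
     \<lparr>carrier = hinf_class Y y ` {f. continuous_map hinf Y f \<and> f None = y},
      monoid.mult = (\<lambda>A B. hinf_class Y y (hinf_concat (SOME f. f \<in> A) (SOME g. g \<in> B))),
      one = hinf_class Y y (\<lambda>_. y)\<rparr>"

end

theory Submission
  imports Defs
begin

text \<open>Composing with the cells \<open>(I\<^sup>n, \<partial>I\<^sup>n) \<rightarrow> (S\<^sup>n\<^sub>k, \<theta>)\<close> sends a class in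
  \<open>\<H>\<^sub>\<infinity>(X, x\<^sub>*)\<close> to a family of classes in \<open>\<pi>\<^sub>n(X, x\<^sub>*)\<close>, and cellwise homotopies glue to a homotopy on
  \<open>\<H>\<^sup>\<infinity>\<close> provided that every neighbourhood of \<open>x\<^sub>*\<close> contains all but finitely many of them.
  Injectivity therefore amounts to replacing the given homotopies between the cells of \<open>f\<close> and \<open>g\<close> by
  small ones. All but finitely many cells of \<open>f\<close> and \<open>g\<close> lie in the neighbourhood \<open>V\<^sub>m\<close> of \<open>x\<^sub>*\<close> made of
  all the \<open>X\<^sub>i\<close> with \<open>i \<ge> m\<close> and of small contractible pieces of the \<open>X\<^sub>i\<close> with \<open>i < m\<close>. Contracting these
  pieces inside slightly larger ones \<open>U\<^sub>m\<close> moves both cells into the weak join of the \<open>X\<^sub>i\<close> with \<open>i \<ge> m\<close>, onto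
  which \<open>X\<close> retracts; the retraction pushes the given homotopy there too. Letting \<open>m\<close> tend to infinity
  along the cells makes the new homotopies small.\<close>

section \<open>Weak joins\<close>

text \<open>Each slice over p lies in the open preimage of \<open>W\<close>, and compactness of
  \<open>Z\<close> thickens it to a tube. Conditions that quantify over a whole time interval
  therefore cut out open sets.\<close>

lemma openin_tube:
  assumes "compact_space Z" and cont: "continuous_map (prod_topology Z X) Y F" and "openin Y W"
  shows "openin X {p \<in> topspace X. \<forall>s\<in>topspace Z. F (s, p) \<in> W}"
proof (subst openin_subopen, intro ballI)
  fix p assume "p \<in> {p \<in> topspace X. \<forall>s\<in>topspace Z. F (s, p) \<in> W}"
  then have p: "p \<in> topspace X" "\<And>s. s \<in> topspace Z \<Longrightarrow> F (s, p) \<in> W" by auto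
  let ?P = "{z \<in> topspace (prod_topology Z X). F z \<in> W}"
  have "openin (prod_topology Z X) ?P"
    using cont \<open>openin Y W\<close> by (rule openin_continuous_map_preimage)
  moreover have "compactin Z (topspace Z)"
    using \<open>compact_space Z\<close> by (simp add: compact_space_def)
  moreover have "topspace Z \<times> {p} \<subseteq> ?P" using p by auto
  ultimately obtain U V where "openin X V" "topspace Z \<subseteq> U" "p \<in> V" "U \<times> V \<subseteq> ?P"
    using tube_lemma_left[of Z X ?P "topspace Z" p] p by blast
  then show "\<exists>T. openin X T \<and> p \<in> T \<and> T \<subseteq> {p \<in> topspace X. \<forall>s\<in>topspace Z. F (s, p) \<in> W}"
    by (intro exI[of _ V]) (auto dest: openin_subset)
qed

lemma openin_weak_join: "openin (weak_join X x) = wj_open X x"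
  unfolding weak_join_def by (rule topology_inverse'[OF istopology_wj_open])

lemma wj_inj_base [simp]: "wj_inj x i (x i) = None"
  by (simp add: wj_inj_def)

lemma wj_inj_in_carrier: "p \<in> topspace (X i) \<Longrightarrow> wj_inj x i p \<in> wj_carrier X x"
  by (auto simp: wj_inj_def wj_carrier_def)

lemma wj_carrier_cases:
  assumes "q \<in> wj_carrier X x"
  obtains "q = None"
  | i p where "p \<in> topspace (X i)" "p \<noteq> x i" "q = Some (i, p)" "q = wj_inj x i p"
  using assms by (auto simp: wj_carrier_def wj_inj_def)

lemma topspace_weak_join: "topspace (weak_join X x) = wj_carrier X x"
proof -
  have "{y \<in> topspace (X i). wj_inj x i y \<in> wj_carrier X x} = topspace (X i)" for i
    using wj_inj_in_carrier by fast
  moreover have "{i. \<not> (wj_inj x i ` topspace (X i) \<subseteq> wj_carrier X x)} = {}"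
    using wj_inj_in_carrier by fast
  ultimately have "wj_open X x (wj_carrier X x)"
    by (simp add: wj_open_def)
  then show ?thesis
    using openin_weak_join[of X x] openin_subset[of "weak_join X x"]
    by (metis openin_topspace subset_antisym wj_open_def)
qed

lemma continuous_map_wj_inj: "continuous_map (X i) (weak_join X x) (wj_inj x i)"
  unfolding continuous_map_def
  by (auto simp: topspace_weak_join wj_inj_in_carrier openin_weak_join wj_open_def)

text \<open>Away from the base point the image meets a single summand and misses
  \<open>None\<close>, so the finiteness condition is vacuous.\<close>

lemma wj_open_image:
  assumes "openin (X i) N" "x i \<notin> N"
  shows "wj_open X x (wj_inj x i ` N)"
proof -
  have "{y \<in> topspace (X j). wj_inj x j y \<in> wj_inj x i ` N} = (if j = i then N else {})" for j
    using assms openin_subset[OF assms(1)] by (auto simp: wj_inj_def split: if_splits)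
  moreover have "None \<notin> wj_inj x i ` N"
    using assms by (auto simp: wj_inj_def split: if_splits)
  ultimately show ?thesis
    using assms openin_subset[OF assms(1)]
    unfolding wj_open_def by (auto intro: wj_inj_in_carrier)
qed

text \<open>\<open>T\<close> already contains the common point and almost all summands, so adding an
  open piece of one summand changes only the trace on that summand.\<close>

lemma wj_open_un_image:
  assumes T: "wj_open X x T" "None \<in> T" and N: "openin (X i) N"
  shows "wj_open X x (T \<union> wj_inj x i ` N)"
proof -
  have "{y \<in> topspace (X j). wj_inj x j y \<in> T \<union> wj_inj x i ` N} =
      {y \<in> topspace (X j). wj_inj x j y \<in> T} \<union> (if j = i then N else {})" for j
    using T openin_subset[OF N] by (auto simp: wj_inj_def split: if_splits)
  moreover have "finite {j. \<not> (wj_inj x j ` topspace (X j) \<subseteq> T \<union> wj_inj x i ` N)}"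
    by (rule finite_subset[of _ "{j. \<not> (wj_inj x j ` topspace (X j) \<subseteq> T)}"])
      (use T in \<open>auto simp: wj_open_def\<close>)
  ultimately show ?thesis
    using T N openin_subset[OF N]
    unfolding wj_open_def by (auto intro: wj_inj_in_carrier openin_Un)
qed

text \<open>The gluing criterion for weak joins: continuity on each summand suffices once almost all
  summands stay near \<open>y\<close> at all times. Compactness of \<open>Z\<close> is what allows
  one neighbourhood of the common point to serve every time \<open>s\<close>.\<close>

lemma continuous_map_prod_weak_join:
  assumes Z: "compact_space Z"
    and base: "\<And>s. s \<in> topspace Z \<Longrightarrow> F (s, None) = y"
    and cont: "\<And>i. continuous_map (prod_topology Z (X i)) Y (\<lambda>(s, p). F (s, wj_inj x i p))"
    and y: "y \<in> topspace Y"
    and null: "\<And>W. openin Y W \<Longrightarrow> y \<in> W \<Longrightarrow>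
      finite {i. \<not> (\<forall>s\<in>topspace Z. \<forall>p\<in>topspace (X i). F (s, wj_inj x i p) \<in> W)}"
  shows "continuous_map (prod_topology Z (weak_join X x)) Y F"
  unfolding continuous_map_def
proof (intro conjI allI impI)
  show "F \<in> topspace (prod_topology Z (weak_join X x)) \<rightarrow> topspace Y"
  proof
    fix z assume "z \<in> topspace (prod_topology Z (weak_join X x))"
    then obtain s q where z: "z = (s, q)" "s \<in> topspace Z" "q \<in> wj_carrier X x"
      by (auto simp: topspace_weak_join)
    from z(3) show "F z \<in> topspace Y"
    proof (cases rule: wj_carrier_cases)
      case 1 then show ?thesis using z base y by simp
    next
      case (2 i p)
      then show ?thesis using z funcset_mem[OF continuous_map_funspace[OF cont[of i]], of "(s, p)"] by simp
    qed
  qed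
next
  fix W assume W: "openin Y W"
  let ?P = "{z \<in> topspace (prod_topology Z (weak_join X x)). F z \<in> W}"
  \<comment> \<open>The points whose whole track lies in \<open>W\<close>. The tube lemma makes its
    traces open, and \<open>null\<close> gives the finiteness condition.\<close>
  let ?T = "{q \<in> wj_carrier X x. \<forall>s\<in>topspace Z. F (s, q) \<in> W}"
  have T: "wj_open X x ?T" if "y \<in> W"
  proof -
    have "{p \<in> topspace (X i). wj_inj x i p \<in> ?T} =
       {p \<in> topspace (X i). \<forall>s\<in>topspace Z. (\<lambda>(s, p). F (s, wj_inj x i p)) (s, p) \<in> W}" for i
      by (auto simp: wj_inj_in_carrier)
    then have "openin (X i) {p \<in> topspace (X i). wj_inj x i p \<in> ?T}" for i
      using openin_tube[OF Z cont[of i] W] by simp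
    moreover have "finite {i. \<not> (wj_inj x i ` topspace (X i) \<subseteq> ?T)}"
      by (rule finite_subset[OF _ null[OF W that]]) (auto simp: wj_inj_in_carrier)
    ultimately show ?thesis unfolding wj_open_def by blast
  qed
  show "openin (prod_topology Z (weak_join X x)) ?P"
    unfolding openin_prod_topology_alt
  proof (intro allI impI)
    fix s q assume "(s, q) \<in> ?P"
    then have s: "s \<in> topspace Z" and q: "q \<in> wj_carrier X x" and F: "F (s, q) \<in> W"
      by (auto simp: topspace_weak_join)
    from q have "\<exists>J N. openin Z J \<and> wj_open X x N \<and> s \<in> J \<and> q \<in> N \<and> (\<forall>s'\<in>J. \<forall>q'\<in>N. F (s', q') \<in> W)"
    proof (cases rule: wj_carrier_cases)
      case 1
      then have "y \<in> W" using F base s by simp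
      with 1 T q base show ?thesis
        by (intro exI[of _ "topspace Z"] exI[of _ ?T]) (auto simp: s)
    next
      case (2 i p)
      let ?Q = "{z \<in> topspace (prod_topology Z (X i)). (\<lambda>(s, p). F (s, wj_inj x i p)) z \<in> W}"
      have "openin (prod_topology Z (X i)) ?Q"
        using cont W by (rule openin_continuous_map_preimage)
      moreover have "(s, p) \<in> ?Q" using s 2 F by simp
      ultimately obtain J N where "openin Z J" "openin (X i) N" "s \<in> J" "p \<in> N" "J \<times> N \<subseteq> ?Q"
        unfolding openin_prod_topology_alt by meson
      then have JN: "openin Z J" "openin (X i) N" "s \<in> J" "p \<in> N"
        "\<And>s' p'. s' \<in> J \<Longrightarrow> p' \<in> N \<Longrightarrow> F (s', wj_inj x i p') \<in> W"
        by auto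
      \<comment> \<open>If \<open>y \<in> W\<close>, the piece \<open>N\<close> may contain the base
        point and is completed by \<open>?T\<close>. Otherwise \<open>N\<close> cannot contain
        \<open>x i\<close>, because F takes the value y there, and its image is open by
        itself.\<close>
      show ?thesis
      proof (cases "y \<in> W")
        case True
        then have "None \<in> ?T" using base by (simp add: wj_carrier_def)
        then have *: "wj_open X x (?T \<union> wj_inj x i ` N)"
          by (rule wj_open_un_image[OF T[OF True] _ JN(2)])
        have "\<forall>s'\<in>J. \<forall>q'\<in>?T \<union> wj_inj x i ` N. F (s', q') \<in> W"
          using JN openin_subset[OF JN(1)] by auto
        moreover have "q \<in> ?T \<union> wj_inj x i ` N" using 2(4) JN(4) by blast
        ultimately show ?thesis using * JN(1,3) by blast
      next
        case False
        then have "x i \<notin> N"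
          using JN(5)[OF JN(3)] base[OF s] by (metis wj_inj_base)
        then have "wj_open X x (wj_inj x i ` N)" using JN by (intro wj_open_image)
        moreover have "q \<in> wj_inj x i ` N" using 2 JN by blast
        ultimately show ?thesis using JN by blast
      qed
    qed
    then obtain J N where "openin Z J" "wj_open X x N" "s \<in> J" "q \<in> N"
      "\<forall>s'\<in>J. \<forall>q'\<in>N. F (s', q') \<in> W" by blast
    then show "\<exists>J N. openin Z J \<and> openin (weak_join X x) N \<and> s \<in> J \<and> q \<in> N \<and> J \<times> N \<subseteq> ?P"
      using openin_subset[of Z J] openin_subset[of "weak_join X x" N]
      by (intro exI[of _ J] exI[of _ N]) (auto simp: openin_weak_join)
  qed
qed

text \<open>Restricting open sets of the weak join is direct. Conversely, traces that are open in
  the smaller summands must be extended to open sets of the \<open>X i\<close> without losing the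
  condition that almost all summands are contained whole.\<close>

lemma subtopology_weak_join:
  assumes S: "None \<in> S"
  shows "subtopology (weak_join X x) S =
    weak_join (\<lambda>i. subtopology (X i) {p \<in> topspace (X i). wj_inj x i p \<in> S}) x"
    (is "_ = weak_join ?X x")
proof -
  have top: "topspace (subtopology (X i) {p \<in> topspace (X i). wj_inj x i p \<in> S}) = {p \<in> topspace (X i). wj_inj x i p \<in> S}" for i
    by auto
  have "(\<exists>T. wj_open X x T \<and> U = T \<inter> S) \<longleftrightarrow> wj_open ?X x U" for U
  proof
    assume "\<exists>T. wj_open X x T \<and> U = T \<inter> S"
    then obtain T where T: "wj_open X x T" "U = T \<inter> S" by blast
    have "{p \<in> topspace (?X i). wj_inj x i p \<in> U} =
        {p \<in> topspace (X i). wj_inj x i p \<in> T} \<inter> {p \<in> topspace (X i). wj_inj x i p \<in> S}" for i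
      using T by auto
    then have "openin (?X i) {p \<in> topspace (?X i). wj_inj x i p \<in> U}" for i
      using T unfolding wj_open_def openin_subtopology by blast
    moreover have "U \<subseteq> wj_carrier ?X x"
    proof
      fix q assume "q \<in> U"
      then have q: "q \<in> wj_carrier X x" "q \<in> S" using T by (auto simp: wj_open_def)
      from q(1) show "q \<in> wj_carrier ?X x"
        by (cases rule: wj_carrier_cases) (use q in \<open>auto simp: wj_carrier_def wj_inj_def\<close>)
    qed
    moreover have "finite {i. \<not> (wj_inj x i ` topspace (?X i) \<subseteq> U)}" if "None \<in> U"
    proof -
      have "finite {i. \<not> (wj_inj x i ` topspace (X i) \<subseteq> T)}"
        using T that unfolding wj_open_def by auto
      then show ?thesis by (rule rev_finite_subset) (use T in auto)
    qed
    ultimately show "wj_open ?X x U" unfolding wj_open_def by blast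
  next
    assume U: "wj_open ?X x U"
    define V where "V i = {p \<in> topspace (X i). wj_inj x i p \<in> S}" for i
    have "\<exists>T. openin (X i) T \<and> {p \<in> V i. wj_inj x i p \<in> U} = T \<inter> V i" for i
    proof -
      have "openin (?X i) {p \<in> topspace (?X i). wj_inj x i p \<in> U}"
        using U by (simp add: wj_open_def)
      moreover have "topspace (subtopology (X i) (V i)) = V i" by (auto simp: V_def)
      ultimately have "openin (subtopology (X i) (V i)) {p \<in> V i. wj_inj x i p \<in> U}"
        unfolding V_def[symmetric] by (simp only:)
      then show ?thesis unfolding openin_subtopology .
    qed
    then obtain T0 where T0: "\<And>i. openin (X i) (T0 i)"
      "\<And>i. {p \<in> V i. wj_inj x i p \<in> U} = T0 i \<inter> V i" by metis
    \<comment> \<open>Taking all of \<open>X i\<close> as soon as the whole trace \<open>V i\<close>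
      maps into \<open>U\<close> preserves the finiteness condition. For the other indices any open
      extension will do.\<close>
    define T where "T i = (if wj_inj x i ` V i \<subseteq> U then topspace (X i) else T0 i)" for i
    have T: "openin (X i) (T i)" "{p \<in> V i. wj_inj x i p \<in> U} = T i \<inter> V i" for i
      using T0[of i] openin_subset[OF T0(1)[of i]] by (auto simp: T_def V_def)
    have T2: "wj_inj x i p \<in> U \<longleftrightarrow> p \<in> T i" if "p \<in> V i" for i p
      using that T(2)[of i] by blast
    \<comment> \<open>\<open>U \<inter> {None}\<close> puts the common point in by hand, since no
      summand is known here to contain its base point.\<close>
    define R where "R = (\<Union>i. wj_inj x i ` T i) \<union> (U \<inter> {None})"
    have sub: "T i \<subseteq> topspace (X i)" for i using T openin_subset by blast
    have Rpre: "{p \<in> topspace (X i). wj_inj x i p \<in> R} =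
       T i" if "x i \<in> topspace (X i) \<Longrightarrow> x i \<in> T i \<longleftrightarrow> None \<in> R" for i
    proof -
      have "wj_inj x i p \<in> R \<longleftrightarrow> p \<in> T i" if "p \<in> topspace (X i)" "p \<noteq> x i" for p
        using that by (auto simp: R_def wj_inj_def split: if_splits)
      then have "wj_inj x i p \<in> R \<longleftrightarrow> p \<in> T i" if "p \<in> topspace (X i)" for p
        using that \<open>x i \<in> topspace (X i) \<Longrightarrow> x i \<in> T i \<longleftrightarrow> None \<in> R\<close> by (cases "p = x i") simp_all
      then show ?thesis using sub[of i] by blast
    qed
    have N1: "None \<in> U" if "x i \<in> T i" for i
    proof -
      have "x i \<in> V i" using that sub S by (auto simp: V_def)
      then show ?thesis using that T2[of "x i" i] by simp
    qed
    have N2: "x i \<in> T i" if "None \<in> U" "x i \<in> topspace (X i)" for i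
    proof -
      have "x i \<in> V i" using that S by (auto simp: V_def)
      then show ?thesis using that T2[of "x i" i] by simp
    qed
    have "None \<in> R \<longleftrightarrow> None \<in> U"
      using N1 by (auto simp: R_def wj_inj_def split: if_splits)
    with N1 N2 have "{p \<in> topspace (X i). wj_inj x i p \<in> R} = T i" for i
      by (intro Rpre) blast
    moreover have "finite {i. \<not> (wj_inj x i ` topspace (X i) \<subseteq> R)}" if "None \<in> R"
    proof -
      have "finite {i. \<not> (wj_inj x i ` V i \<subseteq> U)}"
        using U that \<open>None \<in> R \<longleftrightarrow> None \<in> U\<close> unfolding wj_open_def top V_def by blast
      then show ?thesis
      proof (rule rev_finite_subset)
        have "wj_inj x i ` topspace (X i) \<subseteq> R" if "wj_inj x i ` V i \<subseteq> U" for i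
        proof -
          have "T i = topspace (X i)" using that by (simp add: T_def)
          then show ?thesis unfolding R_def by blast
        qed
        then show "{i. \<not> (wj_inj x i ` topspace (X i) \<subseteq> R)} \<subseteq> {i. \<not> (wj_inj x i ` V i \<subseteq> U)}"
          by blast
      qed
    qed
    moreover have "R \<subseteq> wj_carrier X x"
      using sub by (auto simp: R_def intro!: wj_inj_in_carrier) (auto simp: wj_carrier_def)
    ultimately have "wj_open X x R" using T by (simp add: wj_open_def)
    moreover have "U = R \<inter> S"
    proof (intro equalityI subsetI)
      fix q assume q: "q \<in> U"
      then have "q \<in> wj_carrier ?X x" using U by (auto simp: wj_open_def)
      then show "q \<in> R \<inter> S"
      proof (cases rule: wj_carrier_cases)
        case 1 then show ?thesis using q S by (auto simp: R_def)
      next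
        case (2 i p)
        then have "p \<in> V i" "p \<in> T i" using q sub T2[of p i] S unfolding V_def by auto
        then have "wj_inj x i p \<in> R" "wj_inj x i p \<in> S" unfolding R_def V_def by auto
        then show ?thesis using 2(4) by simp
      qed
    next
      fix q assume q: "q \<in> R \<inter> S"
      show "q \<in> U"
      proof (cases "q \<in> U \<inter> {None}")
        case False
        then obtain i p where p: "p \<in> T i" "q = wj_inj x i p" using q by (auto simp: R_def)
        then have "p \<in> V i" using q sub by (auto simp: V_def)
        then show ?thesis using p T2[of p i] by simp
      qed auto
    qed
    ultimately show "\<exists>T. wj_open X x T \<and> U = T \<inter> S" by blast
  qed
  then show ?thesis
    by (simp add: topology_eq openin_subtopology openin_weak_join)
qed

section \<open>Truncation and basic neighbourhoods of the common point\<close>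

definition wj_truncate :: "nat \<Rightarrow> (nat \<times> 'a) option \<Rightarrow> (nat \<times> 'a) option" where
  "wj_truncate m q = (case q of None \<Rightarrow> None | Some (i, p) \<Rightarrow> if i < m then None else q)"

text \<open>Only \<open>A i\<close> with \<open>i < m\<close> matters. The later summands are
  contained whole, as openness at the common point demands of almost all of them.\<close>

definition wj_nbhd :: "(nat \<Rightarrow> 'a topology) \<Rightarrow> (nat \<Rightarrow> 'a) \<Rightarrow> nat \<Rightarrow> (nat \<Rightarrow> 'a set) \<Rightarrow> (nat \<times> 'a) option set" where
  "wj_nbhd X x m A = {q \<in> wj_carrier X x. \<forall>i p. q = Some (i, p) \<longrightarrow> i < m \<longrightarrow> p \<in> A i}"

lemma wj_truncate_None [simp]: "wj_truncate m None = None"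
  by (simp add: wj_truncate_def)

lemma None_in_wj_nbhd [simp]: "None \<in> wj_nbhd X x m A"
  by (simp add: wj_nbhd_def wj_carrier_def)

lemma wj_truncate_in_nbhd: "q \<in> wj_carrier X x \<Longrightarrow> wj_truncate m q \<in> wj_nbhd X x m A"
  by (cases q) (auto simp: wj_truncate_def wj_nbhd_def wj_carrier_def split: if_splits)

lemma wj_open_wj_nbhd:
  assumes "\<And>i. i < m \<Longrightarrow> openin (X i) (A i)" "\<And>i. i < m \<Longrightarrow> x i \<in> A i"
  shows "wj_open X x (wj_nbhd X x m A)"
proof -
  have "{p \<in> topspace (X i). wj_inj x i p \<in> wj_nbhd X x m A} = (if i < m then A i else topspace (X i))" for i
    using assms[of i] openin_subset[of "X i" "A i"]
    by (auto simp: wj_nbhd_def wj_inj_def wj_carrier_def)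
  moreover have "finite {i. \<not> (wj_inj x i ` topspace (X i) \<subseteq> wj_nbhd X x m A)}"
    by (rule finite_subset[of _ "{..<m}"]) (auto simp: wj_nbhd_def wj_carrier_def wj_inj_def split: if_splits)
  ultimately show ?thesis
    using assms by (auto simp: wj_open_def wj_nbhd_def)
qed

text \<open>The image meets the first m summands at most in the common point, so it lies in
  \<open>wj_nbhd X x m A\<close> for every \<open>A\<close>. This is how a homotopy of any size is
  pushed into a prescribed neighbourhood. On each summand the preimage of an open set is everything,
  empty, or its old trace.\<close>

lemma continuous_map_wj_truncate:
  "continuous_map (weak_join X x) (subtopology (weak_join X x) (wj_nbhd X x m A)) (wj_truncate m)"
proof -
  have car: "wj_truncate m q \<in> wj_carrier X x" if "q \<in> wj_carrier X x" for q
    using wj_truncate_in_nbhd[OF that, of m A] by (simp add: wj_nbhd_def)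
  have "wj_open X x {q \<in> wj_carrier X x. wj_truncate m q \<in> W}" if W: "wj_open X x W" for W
  proof -
    have "{p \<in> topspace (X i). wj_inj x i p \<in> {q \<in> wj_carrier X x. wj_truncate m q \<in> W}} =
        (if i < m then (if None \<in> W then topspace (X i) else {}) else {p \<in> topspace (X i). wj_inj x i p \<in> W})" for i
      by (auto simp: wj_inj_in_carrier) (auto simp: wj_inj_def wj_truncate_def split: if_splits)
    moreover have "finite {i. \<not> (wj_inj x i ` topspace (X i) \<subseteq> {q \<in> wj_carrier X x. wj_truncate m q \<in> W})}"
      if "None \<in> W"
    proof (rule finite_subset)
      show "finite {i. \<not> (wj_inj x i ` topspace (X i) \<subseteq> W)}"
        using W that by (simp add: wj_open_def)
      show "{i. \<not> (wj_inj x i ` topspace (X i) \<subseteq> {q \<in> wj_carrier X x. wj_truncate m q \<in> W})} \<subseteq>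
          {i. \<not> (wj_inj x i ` topspace (X i) \<subseteq> W)}"
      proof
        fix i assume "i \<in> {i. \<not> (wj_inj x i ` topspace (X i) \<subseteq> {q \<in> wj_carrier X x. wj_truncate m q \<in> W})}"
        then obtain p where p: "p \<in> topspace (X i)" "wj_truncate m (wj_inj x i p) \<notin> W"
          using wj_inj_in_carrier by fast
        then have "wj_inj x i p \<notin> W"
          using that by (auto simp: wj_truncate_def wj_inj_def split: if_splits)
        with p show "i \<in> {i. \<not> (wj_inj x i ` topspace (X i) \<subseteq> W)}" by blast
      qed
    qed
    ultimately show ?thesis using W by (auto simp: wj_open_def)
  qed
  then have "continuous_map (weak_join X x) (weak_join X x) (wj_truncate m)"
    unfolding continuous_map_def topspace_weak_join openin_weak_join using car by blast
  then show ?thesis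
    by (auto simp: continuous_map_in_subtopology topspace_weak_join wj_truncate_in_nbhd)
qed

text \<open>The contractions of the \<open>A i\<close> inside the \<open>B i\<close> run
  simultaneously on the first m summands, while the others stay fixed. They agree at the common
  point because each is relative to its base point.\<close>

lemma homotopic_wj_truncate:
  assumes x: "\<And>i. i < m \<Longrightarrow> x i \<in> A i"
    and contr: "\<And>i. i < m \<Longrightarrow> homotopic_with (\<lambda>h. h (x i) = x i)
        (subtopology (X i) (A i)) (subtopology (X i) (B i)) id (\<lambda>_. x i)"
  shows "homotopic_with (\<lambda>h. h None = None)
      (subtopology (weak_join X x) (wj_nbhd X x m A)) (subtopology (weak_join X x) (wj_nbhd X x m B))
      id (wj_truncate m)"
proof -
  let ?I = "top_of_set {0..1::real}"
  let ?S = "wj_nbhd X x m A"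
  let ?X = "\<lambda>i. subtopology (X i) {p \<in> topspace (X i). wj_inj x i p \<in> ?S}"
  have "\<exists>k. i < m \<longrightarrow> continuous_map (prod_topology ?I (subtopology (X i) (A i))) (subtopology (X i) (B i)) k \<and>
       (\<forall>p. k (0, p) = p) \<and> (\<forall>p. k (1, p) = x i) \<and> (\<forall>s\<in>{0..1}. k (s, x i) = x i)" for i
    using contr[of i] by (cases "i < m") (auto simp: homotopic_with_def)
  then obtain k where k: "\<And>i. i < m \<Longrightarrow>
       continuous_map (prod_topology ?I (subtopology (X i) (A i))) (subtopology (X i) (B i)) (k i)"
    "\<And>i p. i < m \<Longrightarrow> k i (0, p) = p" "\<And>i p. i < m \<Longrightarrow> k i (1, p) = x i"
    "\<And>i s. i < m \<Longrightarrow> s \<in> {0..1} \<Longrightarrow> k i (s, x i) = x i"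
    by metis
  define K where "K = (\<lambda>(s, q). case q of None \<Rightarrow> None
      | Some (i, p) \<Rightarrow> if i < m then wj_inj x i (k i (s, p)) else q)"
  \<comment> \<open>At \<open>p = x i\<close> the definition of \<open>K\<close> uses its
    \<open>None\<close> branch; the formula persists because \<open>k i\<close> fixes the base
    point.\<close>
  have Kinj: "K (s, wj_inj x i p) = (if i < m then wj_inj x i (k i (s, p)) else wj_inj x i p)"
    if "s \<in> {0..1}" for s i p
    using k(4)[of i s] that by (auto simp: K_def wj_inj_def)
  have S: "{p \<in> topspace (X i). wj_inj x i p \<in> ?S} = (if i < m then topspace (X i) \<inter> A i else topspace (X i))" for i
    using x[of i] by (auto simp: wj_nbhd_def wj_inj_def wj_carrier_def)
  have S': "?X i = (if i < m then subtopology (X i) (A i) else X i)" for i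
    unfolding S by (simp add: subtopology_restrict)
  have Kcont: "continuous_map (prod_topology ?I (subtopology (weak_join X x) ?S)) (weak_join X x) K"
    unfolding subtopology_weak_join[OF None_in_wj_nbhd]
  proof (rule continuous_map_prod_weak_join[where y = None])
    show "compact_space ?I" by (simp add: compact_space_subtopology)
    show "K (s, None) = None" for s by (simp add: K_def)
    show "None \<in> topspace (weak_join X x)" by (simp add: topspace_weak_join wj_carrier_def)
    fix i
    show "continuous_map (prod_topology ?I (?X i)) (weak_join X x) (\<lambda>(s, p). K (s, wj_inj x i p))"
    proof (cases "i < m")
      case True
      have "continuous_map (prod_topology ?I (subtopology (X i) (A i))) (X i) (k i)"
        using k(1)[OF True] by (simp add: continuous_map_in_subtopology)
      then have "continuous_map (prod_topology ?I (?X i)) (weak_join X x) (wj_inj x i \<circ> k i)"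
        unfolding S' using True by (intro continuous_map_compose[OF _ continuous_map_wj_inj]) simp
      then show ?thesis
        by (rule continuous_map_eq) (use True in \<open>auto simp: Kinj\<close>)
    next
      case False
      have "continuous_map (prod_topology ?I (?X i)) (weak_join X x) (wj_inj x i \<circ> snd)"
        unfolding S' using False
        by (intro continuous_map_compose[OF _ continuous_map_wj_inj]) (simp add: continuous_map_snd)
      then show ?thesis
        by (rule continuous_map_eq) (use False in \<open>auto simp: Kinj\<close>)
    qed
  next
    fix W assume "openin (weak_join X x) W" "None \<in> W"
    then have "finite {i. \<not> (wj_inj x i ` topspace (X i) \<subseteq> W)}"
      by (simp add: openin_weak_join wj_open_def)
    \<comment> \<open>Only the first m summands move, so any other summand that leaves
      \<open>W\<close> was not contained in \<open>W\<close> to begin with.\<close>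
    then have "finite ({..<m} \<union> {i. \<not> (wj_inj x i ` topspace (X i) \<subseteq> W)})" by simp
    then show "finite {i. \<not> (\<forall>s\<in>topspace ?I. \<forall>p\<in>topspace (?X i). K (s, wj_inj x i p) \<in> W)}"
      by (rule rev_finite_subset) (auto simp: Kinj)
  qed
  have "K (s, q) \<in> wj_nbhd X x m B" if s: "s \<in> {0..1}" and q: "q \<in> wj_carrier X x" "q \<in> ?S" for s q
  proof -
    from q(1) show ?thesis
    proof (cases rule: wj_carrier_cases)
      case 1 then show ?thesis by (simp add: K_def)
    next
      case (2 i p)
      show ?thesis
      proof (cases "i < m")
        case True
        then have "p \<in> topspace (X i) \<inter> A i" using q 2 by (auto simp: wj_nbhd_def)
        then have "k i (s, p) \<in> topspace (X i) \<inter> B i"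
          using continuous_map_funspace[OF k(1)[OF True]] s by auto
        then show ?thesis using True 2
          by (auto simp: K_def wj_nbhd_def wj_inj_in_carrier) (auto simp: wj_inj_def split: if_splits)
      next
        case False
        then show ?thesis using q(1) 2(3) by (auto simp: K_def wj_nbhd_def)
      qed
    qed
  qed
  then have "continuous_map (prod_topology ?I (subtopology (weak_join X x) ?S))
      (subtopology (weak_join X x) (wj_nbhd X x m B)) K"
    using Kcont by (auto simp: continuous_map_in_subtopology topspace_weak_join)
  moreover have "K (0, q) = id q" "K (1, q) = wj_truncate m q" if "q \<in> ?S" for q
    using that k(2,3)
    by (auto simp: K_def wj_truncate_def wj_nbhd_def wj_carrier_def wj_inj_def split: option.splits)
  moreover have K0: "K (s, None) = None" for s by (simp add: K_def)
  moreover have None_car: "None \<in> wj_carrier X x" by (simp add: wj_carrier_def)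
  ultimately show ?thesis
    by (subst homotopic_with)
      (auto simp: K0 topspace_weak_join None_car intro!: exI[of _ K])
qed

section \<open>Cubes and spheres\<close>

lemma Euclidean_space_eq_top_of_set: "Euclidean_space n = top_of_set {x. \<forall>i\<ge>n. x i = 0}"
  by (simp add: Euclidean_space_def euclidean_product_topology)

lemma cube_top_eq: "cube_top n = top_of_set (icube n)"
proof -
  have "{x. \<forall>i\<ge>n. x i = 0} \<inter> icube n = icube n" by (auto simp: icube_def)
  then show ?thesis
    by (simp add: cube_top_def Euclidean_space_eq_top_of_set subtopology_subtopology)
qed

lemma hawaiian_eq: "hawaiian n = top_of_set (\<Union>k\<in>{1..}. hsphere n k)"
proof -
  have "{x. \<forall>i\<ge>Suc n. x i = 0} \<inter> (\<Union>k\<in>{1..}. hsphere n k) = (\<Union>k\<in>{1..}. hsphere n k)"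
    by (auto simp: hsphere_def)
  then show ?thesis
    by (simp add: hawaiian_def Euclidean_space_eq_top_of_set subtopology_subtopology)
qed

lemma topspace_cube_top [simp]: "topspace (cube_top n) = icube n"
  by (simp add: cube_top_eq)

lemma topspace_hawaiian: "topspace (hawaiian n) = (\<Union>k\<in>{1..}. hsphere n k)"
  by (simp add: hawaiian_eq)

text \<open>As a product over \<open>nat\<close> of unit intervals and singletons, the cube is
  compact by Tychonoff's theorem.\<close>

lemma compact_icube: "compact (icube n)"
proof -
  have "(t::nat \<Rightarrow> real) i \<in> (if i < n then {0..1} else {0}) \<longleftrightarrow>
      (i < n \<longrightarrow> 0 \<le> t i \<and> t i \<le> 1) \<and> (n \<le> i \<longrightarrow> t i = 0)" for t i
    by auto
  then have "icube n = PiE UNIV (\<lambda>i. if i < n then {0..1} else {0})"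
    unfolding PiE_UNIV_domain icube_def Pi_def by blast
  moreover have "compactin (product_topology (\<lambda>i. euclidean) UNIV)
      (PiE UNIV (\<lambda>i. if i < n then {0..1::real} else {0}))"
    by (auto simp: compactin_PiE)
  ultimately show ?thesis by (simp add: euclidean_product_topology)
qed

lemma icube_boundary_iff:
  "t \<in> icube n \<Longrightarrow> t \<in> cube_boundary n \<longleftrightarrow> \<not> (\<forall>i<n. 0 < t i \<and> t i < 1)"
  unfolding cube_boundary_def icube_def by (auto simp: order_less_le)

lemma cube_boundary_subset: "cube_boundary n \<subseteq> icube n"
  by (auto simp: cube_boundary_def)

text \<open>Expanding the square cancels \<open>(1 / k)^2\<close>. In this form the inversion
  \<open>p / |p|^2\<close> visibly carries the sphere minus \<open>theta\<close> to the hyperplane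
  with zeroth coordinate \<open>k / 2\<close>.\<close>

lemma hsphere_iff:
  "p \<in> hsphere n k \<longleftrightarrow> (\<forall>i>n. p i = 0) \<and> (\<Sum>j\<le>n. (p j)\<^sup>2) = 2 * p 0 / real k"
proof -
  have "(\<Sum>j\<le>n. (p j)\<^sup>2) = (p 0)\<^sup>2 + (\<Sum>j\<in>{1..n}. (p j)\<^sup>2)"
    by (simp add: sum.atLeast_Suc_atMost atLeast0AtMost[symmetric])
  then show ?thesis
    by (auto simp: hsphere_def power2_diff)
qed

lemma theta_in_hsphere [simp]: "theta \<in> hsphere n k"
  by (simp add: hsphere_iff theta_def)

lemma hsphere_norm_pos:
  assumes "p \<in> hsphere n k" "p \<noteq> theta"
  shows "(\<Sum>j\<le>n. (p j)\<^sup>2) > 0"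
proof -
  obtain j where "p j \<noteq> 0" using assms by (auto simp: theta_def)
  moreover have "j \<le> n" using assms(1) \<open>p j \<noteq> 0\<close> by (meson hsphere_iff not_le)
  ultimately show ?thesis by (intro sum_pos2[of _ j]) auto
qed

text \<open>The ratio is the zeroth coordinate of the inverted point. It recovers k from p, so
  distinct spheres meet only at \<open>theta\<close>.\<close>

lemma hsphere_ratio:
  assumes "p \<in> hsphere n k" "p \<noteq> theta" "1 \<le> k"
  shows "p 0 / (\<Sum>j\<le>n. (p j)\<^sup>2) = real k / 2"
  using hsphere_norm_pos[OF assms(1,2)] assms by (auto simp: hsphere_iff field_simps)

lemma hsphere_unique:
  assumes "p \<in> hsphere n k" "p \<in> hsphere n l" "p \<noteq> theta" "1 \<le> k" "1 \<le> l"
  shows "k = l"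
  using hsphere_ratio[OF assms(1,3,4)] hsphere_ratio[OF assms(2,3,5)] by simp

text \<open>Every squared coordinate is at most \<open>|p|^2 = 2 * p 0 / k\<close>. Coordinate 0
  gives \<open>p 0 \<le> 2 / k\<close>, and feeding this back bounds the rest.\<close>

lemma hsphere_coord_bound:
  assumes "p \<in> hsphere n k" "1 \<le> k"
  shows "\<bar>p i\<bar> \<le> 2 / real k"
proof -
  have sq: "(p j)\<^sup>2 \<le> 2 * p 0 / real k" for j
  proof (cases "j \<le> n")
    case True
    then have "(p j)\<^sup>2 \<le> (\<Sum>j\<le>n. (p j)\<^sup>2)" by (intro member_le_sum) auto
    then show ?thesis using assms(1) by (simp add: hsphere_iff)
  next
    case False
    have "(\<Sum>j\<le>n. (p j)\<^sup>2) \<ge> 0" by (intro sum_nonneg) auto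
    then show ?thesis using False assms(1) by (simp add: hsphere_iff)
  qed
  have k: "real k > 0" using assms by simp
  have "0 \<le> 2 * p 0 / real k" using sq[of 0] by (rule order_trans[rotated]) simp
  then have "p 0 \<ge> 0" using k by (simp add: zero_le_divide_iff)
  moreover have "p 0 \<le> 2 / real k" if "p 0 > 0"
    using sq[of 0] that k by (simp add: power2_eq_square field_simps)
  ultimately have "p 0 \<le> 2 / real k" using k by (cases "p 0 = 0") auto
  then have "2 * p 0 / real k \<le> 2 * (2 / real k) / real k"
    using k by (intro divide_right_mono mult_left_mono) auto
  then have "(p i)\<^sup>2 \<le> (2 / real k)\<^sup>2"
    using sq[of i] by (simp add: power2_eq_square)
  then show ?thesis using k by (simp add: abs_le_square_iff[symmetric])
qed

text \<open>\<open>D\<close> is the squared norm of the hyperplane point with coordinates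
  \<open>k / 2\<close> and the \<psi> i; inversion turns the squared norm into its
  reciprocal.\<close>

lemma cube_to_sphere_norm:
  assumes t: "\<forall>i<n. 0 < t i \<and> t i < 1" and k: "1 \<le> k"
  defines "\<psi> \<equiv> \<lambda>i. ln (t i / (1 - t i))"
  defines "D \<equiv> (real k)\<^sup>2 / 4 + (\<Sum>i<n. (\<psi> i)\<^sup>2)"
  shows "D > 0" "(\<Sum>j\<le>n. (cube_to_sphere n k t j)\<^sup>2) = 1 / D"
    and "cube_to_sphere n k t = (\<lambda>j. if j = 0 then (real k / 2) / D else if j \<le> n then \<psi> (j - 1) / D else 0)"
proof -
  show D: "D > 0" unfolding D_def using k by (intro add_pos_nonneg sum_nonneg) auto
  show eq: "cube_to_sphere n k t = (\<lambda>j. if j = 0 then (real k / 2) / D else if j \<le> n then \<psi> (j - 1) / D else 0)"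
    using t unfolding cube_to_sphere_def Let_def D_def \<psi>_def by (simp cong: if_cong)
  have "(\<Sum>j\<le>n. (cube_to_sphere n k t j)\<^sup>2) =
      ((real k / 2) / D)\<^sup>2 + (\<Sum>i<n. (cube_to_sphere n k t (Suc i))\<^sup>2)"
    by (subst sum.atMost_shift) (simp add: eq)
  also have "(\<Sum>i<n. (cube_to_sphere n k t (Suc i))\<^sup>2) = (\<Sum>i<n. (\<psi> i)\<^sup>2 / D\<^sup>2)"
    by (intro sum.cong) (auto simp: eq power_divide)
  also have "((real k / 2) / D)\<^sup>2 + (\<Sum>i<n. (\<psi> i)\<^sup>2 / D\<^sup>2) = D / D\<^sup>2"
  proof -
    have "((real k / 2) / D)\<^sup>2 + S / D\<^sup>2 = ((real k)\<^sup>2 / 4 + S) / D\<^sup>2" for S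
      by (simp add: power_divide add_divide_distrib)
    then show ?thesis unfolding sum_divide_distrib[symmetric] D_def .
  qed
  finally show "(\<Sum>j\<le>n. (cube_to_sphere n k t j)\<^sup>2) = 1 / D"
    using D by (simp add: power2_eq_square)
qed

lemma cube_to_sphere_boundary: "t \<in> cube_boundary n \<Longrightarrow> cube_to_sphere n k t = theta"
  using icube_boundary_iff[of t n] cube_boundary_subset[of n] by (auto simp: cube_to_sphere_def)

lemma cube_to_sphere_in:
  assumes "1 \<le> k"
  shows "cube_to_sphere n k t \<in> hsphere n k"
proof (cases "\<forall>i<n. 0 < t i \<and> t i < 1")
  case True
  note c = cube_to_sphere_norm[OF True assms]
  have "1 / D = 2 * (real k / 2 / D) / real k" for D using assms by simp
  then show ?thesis unfolding hsphere_iff c(2) by (simp add: c(3) del: divide_divide_eq_left divide_divide_eq_left')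
next
  case False
  then have "cube_to_sphere n k t = theta" unfolding cube_to_sphere_def by (rule if_not_P)
  then show ?thesis by simp
qed

lemma cube_to_sphere_neq_theta:
  assumes t: "\<forall>i<n. 0 < t i \<and> t i < 1" and k: "1 \<le> k"
  shows "cube_to_sphere n k t \<noteq> theta"
proof
  assume "cube_to_sphere n k t = theta"
  then have "cube_to_sphere n k t 0 = 0" by (simp add: theta_def)
  with cube_to_sphere_norm[OF t k] k show False by simp
qed

lemma sphere_to_cube_interior: "i < n \<Longrightarrow> 0 < sphere_to_cube n p i \<and> sphere_to_cube n p i < 1"
  by (simp add: sphere_to_cube_def Let_def add_pos_pos)

lemma sphere_to_cube_in_icube: "sphere_to_cube n p \<in> icube n"
  using sphere_to_cube_interior[of _ n p]
  by (auto simp: icube_def less_imp_le) (simp add: sphere_to_cube_def Let_def)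

text \<open>Dividing by the squared norm \<open>1 / D\<close> recovers the logits of the
  \<open>t i\<close>, which the logistic function inverts. Membership in \<open>icube n\<close>
  settles the coordinates from n on.\<close>

lemma sphere_to_cube_to_sphere:
  assumes "t \<in> icube n" and t: "\<forall>i<n. 0 < t i \<and> t i < 1" and k: "1 \<le> k"
  shows "sphere_to_cube n (cube_to_sphere n k t) = t"
proof
  fix i
  note c = cube_to_sphere_norm[OF t k]
  show "sphere_to_cube n (cube_to_sphere n k t) i = t i"
  proof (cases "i < n")
    case True
    then have ti: "0 < t i" "t i < 1" using t by auto
    have "sphere_to_cube n (cube_to_sphere n k t) i = 1 / (1 + exp (- ln (t i / (1 - t i))))"
      unfolding sphere_to_cube_def Let_def c(2) using True c(1) by (simp add: c(3))
    also have "exp (- ln (t i / (1 - t i))) = (1 - t i) / t i"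
      using ti by (simp add: exp_minus)
    also have "1 / (1 + (1 - t i) / t i) = t i"
      using ti by (simp add: field_simps)
    finally show ?thesis .
  next
    case False
    then show ?thesis using assms(1) by (simp add: sphere_to_cube_def Let_def icube_def)
  qed
qed

lemma cube_to_sphere_to_cube:
  assumes p: "p \<in> hsphere n k" "p \<noteq> theta" and k: "1 \<le> k"
  shows "cube_to_sphere n k (sphere_to_cube n p) = p"
proof -
  define N where "N = (\<Sum>j\<le>n. (p j)\<^sup>2)"
  have N: "N > 0" unfolding N_def by (rule hsphere_norm_pos[OF p])
  let ?t = "sphere_to_cube n p"
  have t: "\<forall>i<n. 0 < ?t i \<and> ?t i < 1" by (simp add: sphere_to_cube_interior)
  note c = cube_to_sphere_norm[OF t k]
  have \<psi>: "ln (?t i / (1 - ?t i)) = p (Suc i) / N" if "i < n" for i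
  proof -
    define E where "E = exp (- (p (Suc i) / N))"
    have "E > 0" by (simp add: E_def)
    have ti: "?t i = 1 / (1 + E)" using that by (simp add: sphere_to_cube_def Let_def E_def N_def)
    have "1 - 1 / (1 + E) = E / (1 + E)" using \<open>E > 0\<close> by (simp add: field_simps)
    then have "?t i / (1 - ?t i) = 1 / E" using \<open>E > 0\<close> by (simp add: ti)
    also have "\<dots> = exp (p (Suc i) / N)" by (simp add: E_def exp_minus divide_inverse)
    finally show ?thesis by simp
  qed
  have p0: "p 0 = real k / 2 * N" using hsphere_ratio[OF p k] N by (simp add: N_def[symmetric] field_simps)
  have "(\<Sum>i<n. (p (Suc i))\<^sup>2) = N - (p 0)\<^sup>2"
    unfolding N_def by (subst sum.atMost_shift) simp
  then have "(\<Sum>i<n. (p (Suc i) / N)\<^sup>2) = (N - (p 0)\<^sup>2) / N\<^sup>2"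
    by (simp add: power_divide sum_divide_distrib[symmetric])
  \<comment> \<open>With \<open>p 0 = k * N / 2\<close> the sum is
    \<open>k^2 / 4 + 1 / N - k^2 / 4\<close>: the denominator used by \<open>cube_to_sphere\<close>
    is exactly \<open>1 / N\<close>, so inverting twice returns p.\<close>
  then have D: "(real k)\<^sup>2 / 4 + (\<Sum>i<n. (ln (?t i / (1 - ?t i)))\<^sup>2) = 1 / N"
    using N by (simp add: \<psi> p0 power_mult_distrib power_divide diff_divide_distrib) (simp add: power2_eq_square)
  show ?thesis
  proof
    fix j
    show "cube_to_sphere n k ?t j = p j"
      unfolding c(3) D using N p0 p(1) \<psi>[of "j - 1"] by (auto simp: hsphere_iff)
  qed
qed

section \<open>Continuity of the cell maps and of their inverse\<close>

lemma continuous_on_coordinate [continuous_intros]: "continuous_on S (\<lambda>p. p i)"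
  for S :: "('a \<Rightarrow> 'b::topological_space) set"
  by (rule continuous_on_product_then_coordinatewise[OF continuous_on_id])

text \<open>The formula does not mention k, so one argument covers all spheres at once; the squared
  norm vanishes only at \<open>theta\<close>.\<close>

lemma continuous_on_sphere_to_cube:
  "continuous_on ((\<Union>k\<in>{1..}. hsphere n k) - {theta}) (sphere_to_cube n)"
proof (rule continuous_on_coordinatewise_then_product)
  fix i
  have "(\<Sum>j\<le>n. (p j)\<^sup>2) \<noteq> 0" if "p \<in> (\<Union>k\<in>{1..}. hsphere n k) - {theta}" for p
    using that hsphere_norm_pos by fastforce
  moreover have "1 + exp u \<noteq> 0" for u :: real by (smt (verit) exp_gt_zero)
  ultimately show "continuous_on ((\<Union>k\<in>{1..}. hsphere n k) - {theta}) (\<lambda>p. sphere_to_cube n p i)"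
    unfolding sphere_to_cube_def Let_def by (cases "i < n") (auto intro!: continuous_intros)
qed

lemma openin_hawaiian_minus: "openin (hawaiian n) ((\<Union>k\<in>{1..}. hsphere n k) - {theta})"
  unfolding hawaiian_eq by (intro openin_delete) simp

lemma openin_sphere_minus:
  assumes k: "1 \<le> k"
  shows "openin (hawaiian n) (hsphere n k - {theta})"
proof -
  let ?H = "(\<Union>k\<in>{1..}. hsphere n k) - {theta}"
  let ?r = "\<lambda>p. p 0 / (\<Sum>j\<le>n. (p j)\<^sup>2)"
  have "(\<Sum>j\<le>n. (p j)\<^sup>2) \<noteq> 0" if "p \<in> ?H" for p
    using that hsphere_norm_pos by fastforce
  then have "continuous_on ?H ?r"
    by (intro continuous_intros) auto
  \<comment> \<open>The ratio equals \<open>l / 2\<close> on the sphere with index l. These values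
    are spaced by 1/2, so a window of radius 1/4 isolates index k.\<close>
  then have "openin (top_of_set ?H) (?H \<inter> ?r -` {real k / 2 - 1/4 <..< real k / 2 + 1/4})"
    by (rule continuous_openin_preimage_gen) auto
  also have "?H \<inter> ?r -` {real k / 2 - 1/4 <..< real k / 2 + 1/4} = hsphere n k - {theta}"
  proof (intro equalityI subsetI)
    fix p assume p: "p \<in> ?H \<inter> ?r -` {real k / 2 - 1/4 <..< real k / 2 + 1/4}"
    then obtain l where l: "1 \<le> l" "p \<in> hsphere n l" "p \<noteq> theta" by auto
    have "l = k" using p hsphere_ratio[OF l(2,3,1)] by auto
    then show "p \<in> hsphere n k - {theta}" using l by simp
  next
    fix p assume p: "p \<in> hsphere n k - {theta}"
    then show "p \<in> ?H \<inter> ?r -` {real k / 2 - 1/4 <..< real k / 2 + 1/4}"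
      using k hsphere_ratio[of p n k] by auto
  qed
  finally show ?thesis
    using openin_hawaiian_minus[of n] unfolding hawaiian_eq
    by (metis openin_trans)
qed

text \<open>In the open cube the map is a composition of continuous functions. Towards a face some
  logit is unbounded, hence the denominator tends to infinity, and each coordinate has square at
  most its reciprocal.\<close>

lemma continuous_on_cube_to_sphere:
  assumes k: "1 \<le> k"
  shows "continuous_on (icube n) (cube_to_sphere n k)"
proof (rule continuous_on_coordinatewise_then_product, unfold continuous_on_eq_continuous_within, intro ballI)
  fix j t assume t: "t \<in> icube n"
  show "continuous (at t within icube n) (\<lambda>t. cube_to_sphere n k t j)"
  proof (cases "\<forall>i<n. 0 < t i \<and> t i < 1")
    case True
    define \<psi> :: "nat \<Rightarrow> (nat \<Rightarrow> real) \<Rightarrow> real" where "\<psi> i s = ln (s i / (1 - s i))" for i s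
    define D where "D s = (real k)\<^sup>2 / 4 + (\<Sum>i<n. (\<psi> i s)\<^sup>2)" for s
    define U where "U = {s::nat \<Rightarrow> real. \<forall>i<n. 0 < s i \<and> s i < 1}"
    have "U = (\<Inter>i<n. {s. 0 < s i} \<inter> {s. s i < 1})" by (auto simp: U_def)
    moreover have "open {s::nat\<Rightarrow>real. 0 < s i}" "open {s::nat\<Rightarrow>real. s i < 1}" for i
      by (auto intro!: open_Collect_less continuous_intros)
    ultimately have "open U" by auto
    have \<psi>: "continuous_on U (\<psi> i)" if "i < n" for i
      using that unfolding \<psi>_def U_def by (intro continuous_intros) fastforce+
    have D: "continuous_on U D" unfolding D_def
      by (intro continuous_intros \<psi>) auto
    have Dpos: "D s \<noteq> 0" if "s \<in> U" for s
      using cube_to_sphere_norm(1)[OF _ k, of n s] that unfolding U_def D_def \<psi>_def by simp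
    have "continuous_on U (\<lambda>s. if j = 0 then (real k / 2) / D s else if j \<le> n then \<psi> (j - 1) s / D s else 0)"
      by (cases "j = 0"; cases "j \<le> n") (auto intro!: continuous_intros D \<psi> simp: Dpos)
    then have "continuous_on U (\<lambda>s. cube_to_sphere n k s j)"
      by (rule continuous_on_eq)
        (use cube_to_sphere_norm(3)[OF _ k, of n] in \<open>simp add: U_def D_def \<psi>_def\<close>)
    then have "continuous (at t) (\<lambda>s. cube_to_sphere n k s j)"
      using \<open>open U\<close> True by (simp add: continuous_on_eq_continuous_at U_def)
    then show ?thesis by (rule continuous_at_imp_continuous_at_within)
  next
    case False
    then obtain i where i: "i < n" "t i = 0 \<or> t i = 1"
      using t icube_boundary_iff[OF t] by (auto simp: cube_boundary_def)
    have ct: "cube_to_sphere n k t j = 0"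
      using False t by (simp add: icube_boundary_iff cube_to_sphere_boundary theta_def)
    have "\<forall>\<^sub>F s in at t within icube n. dist (cube_to_sphere n k s j) 0 < e" if e: "e > 0" for e
    proof -
      \<comment> \<open>Within this distance of the face the logit of \<open>s i\<close> exceeds
        \<open>M = 1 / e\<close> in absolute value. Hence the denominator exceeds
        \<open>M^2\<close>, and the coordinate is smaller than \<open>1 / M = e\<close>.\<close>
      define \<delta> where "\<delta> = 1 / (1 + exp (1 / e))"
      have \<delta>: "\<delta> > 0" by (simp add: \<delta>_def add_pos_pos)
      have "((\<lambda>s. s i) \<longlongrightarrow> t i) (at t within icube n)"
        using continuous_on_coordinate[of "icube n" i] t by (simp add: continuous_on_def)
      then have "\<forall>\<^sub>F s in at t within icube n. dist (s i) (t i) < \<delta>"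
        using \<delta> by (rule tendstoD)
      then show ?thesis
      proof eventually_elim
        case (elim s)
        show ?case
        proof (cases "\<forall>i<n. 0 < s i \<and> s i < 1")
          case True
          let ?u = "s i"
          have u: "0 < ?u" "?u < 1" using True i by auto
          define M where "M = 1 / e"
          have M: "M > 0" using e by (simp add: M_def)
          have big: "\<bar>ln (?u / (1 - ?u))\<bar> > M"
          proof (cases "t i = 0")
            case True
            then have "?u < 1 / (1 + exp M)" using elim u by (simp add: dist_real_def \<delta>_def M_def)
            then have "?u * exp M < 1 - ?u" by (simp add: field_simps add_pos_pos)
            then have "exp M < (1 - ?u) / ?u" using u by (simp add: field_simps)
            then have "ln (exp M) < ln ((1 - ?u) / ?u)" using u by (subst ln_less_cancel_iff) auto
            then have "M < ln ((1 - ?u) / ?u)" by simp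
            also have "\<dots> = - ln (?u / (1 - ?u))" using u by (simp add: ln_div)
            finally show ?thesis by linarith
          next
            case False
            then have "1 - ?u < 1 / (1 + exp M)" using elim u i by (simp add: dist_real_def \<delta>_def M_def)
            then have "(1 - ?u) * (1 + exp M) < 1"
              by (subst (asm) pos_less_divide_eq) (simp_all add: add_pos_pos)
            then have "(1 - ?u) * exp M < ?u" by (simp add: algebra_simps)
            then have "exp M < ?u / (1 - ?u)" using u by (simp add: field_simps)
            then have "ln (exp M) < ln (?u / (1 - ?u))" using u by (subst ln_less_cancel_iff) auto
            then have "M < ln (?u / (1 - ?u))" by simp
            then show ?thesis by linarith
          qed
          note c = cube_to_sphere_norm[OF True k]
          have "(ln (?u / (1 - ?u)))\<^sup>2 \<le> (\<Sum>i<n. (ln (s i / (1 - s i)))\<^sup>2)"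
            using i by (intro member_le_sum) auto
          moreover have "M\<^sup>2 < (ln (?u / (1 - ?u)))\<^sup>2"
            using power_strict_mono[OF big, of 2] M by simp
          ultimately have DM: "M\<^sup>2 < (real k)\<^sup>2 / 4 + (\<Sum>i<n. (ln (s i / (1 - s i)))\<^sup>2)" (is "_ < ?D")
            by (smt (verit) divide_nonneg_nonneg zero_le_power2)
          have "(cube_to_sphere n k s j)\<^sup>2 \<le> 1 / ?D"
          proof (cases "j \<le> n")
            case True
            then have "(cube_to_sphere n k s j)\<^sup>2 \<le> (\<Sum>j\<le>n. (cube_to_sphere n k s j)\<^sup>2)"
              by (intro member_le_sum) auto
            then show ?thesis unfolding c(2) .
          next
            case False
            then have "cube_to_sphere n k s j = 0" unfolding c(3) by simp
            then show ?thesis using c(1) by simp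
          qed
          also have "1 / ?D < 1 / M\<^sup>2" using DM M by (intro divide_strict_left_mono mult_pos_pos c(1)) auto
          also have "1 / M\<^sup>2 = e\<^sup>2" by (simp add: M_def power_divide)
          finally have "\<bar>cube_to_sphere n k s j\<bar> < e"
            using e power2_less_imp_less[of "\<bar>cube_to_sphere n k s j\<bar>" e] by simp
          then show ?thesis by simp
        next
          case False
          then have "cube_to_sphere n k s = theta" unfolding cube_to_sphere_def by (rule if_not_P)
          then show ?thesis using e by (simp add: theta_def)
        qed
      qed
    qed
    then show ?thesis unfolding continuous_within ct by (rule tendstoI)
  qed
qed

lemma continuous_map_cube_to_sphere:
  assumes "1 \<le> k"
  shows "continuous_map (cube_top n) (hawaiian n) (cube_to_sphere n k)"
  using continuous_on_cube_to_sphere[OF assms] cube_to_sphere_in[OF assms] assms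
  by (auto simp: cube_top_eq hawaiian_eq)

text \<open>Points chosen outside \<open>W\<close> on infinitely many spheres would converge to
  \<open>theta\<close>, since the coordinates on the sphere with index k are at most
  \<open>2 / k\<close>.\<close>

lemma eventually_hsphere_subset:
  assumes W: "openin (hawaiian n) W" "theta \<in> W"
  shows "finite {k. 1 \<le> k \<and> \<not> hsphere n k \<subseteq> W}"
proof -
  \<comment> \<open>The default \<open>theta\<close> lies on every sphere, so \<open>p k\<close>
    belongs to \<open>hsphere n k\<close> for all k and the coordinate bound applies along the whole
    sequence.\<close>
  define p where "p k = (if 1 \<le> k \<and> \<not> hsphere n k \<subseteq> W then SOME p. p \<in> hsphere n k - W else theta)" for k
  have p: "p k \<in> hsphere n k - W" if "1 \<le> k" "\<not> hsphere n k \<subseteq> W" for k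
    using that someI_ex[of "\<lambda>p. p \<in> hsphere n k - W"] unfolding p_def by auto
  have pk: "p k \<in> hsphere n k" for k using p[of k] by (cases "1 \<le> k \<and> \<not> hsphere n k \<subseteq> W") (auto simp: p_def)
  have "(\<lambda>k. p k i) \<longlonglongrightarrow> 0" for i
  proof (rule Lim_null_comparison)
    show "\<forall>\<^sub>F k in sequentially. norm (p k i) \<le> 2 / real k"
      using hsphere_coord_bound[OF pk] by (auto simp: eventually_sequentially)
    show "(\<lambda>k. 2 / real k) \<longlonglongrightarrow> 0" by (rule lim_const_over_n)
  qed
  then have lim: "limitin euclidean p theta sequentially"
    unfolding euclidean_product_topology[symmetric] limitin_componentwise
    by (simp add: theta_def)
  obtain T where T: "open T" "W = T \<inter> (\<Union>k\<in>{1..}. hsphere n k)"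
    using W by (auto simp: hawaiian_eq openin_open)
  have "\<forall>\<^sub>F k in sequentially. p k \<in> T"
    using lim T W by (auto simp: limitin_def)
  then obtain K where K: "\<And>k. k \<ge> K \<Longrightarrow> p k \<in> T" by (auto simp: eventually_sequentially)
  have "k < K" if "1 \<le> k" "\<not> hsphere n k \<subseteq> W" for k
    using p[OF that] K[of k] T that by (meson DiffE IntI UN_I atLeast_iff not_le)
  then have "{k. 1 \<le> k \<and> \<not> hsphere n k \<subseteq> W} \<subseteq> {..<K}" by auto
  then show ?thesis by (rule finite_subset) simp
qed

section \<open>The Hawaiian earring as a union of cubes\<close>

text \<open>\<open>theta\<close> itself comes from the zero corner of a cube, which is a boundary
  point because \<open>1 \<le> n\<close>. Every other point comes from the inverse of its cell
  map.\<close>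

lemma hawaiian_cell:
  assumes "p \<in> topspace (hawaiian n)" "1 \<le> n"
  obtains k t where "1 \<le> k" "t \<in> icube n" "p = cube_to_sphere n k t"
proof (cases "p = theta")
  case True
  have "(\<lambda>_. 0) \<in> cube_boundary n" using assms(2) by (auto simp: cube_boundary_def icube_def intro!: exI[of _ 0])
  then show ?thesis
    using that[of 1 "\<lambda>_. 0"] True cube_boundary_subset by (auto simp: cube_to_sphere_boundary)
next
  case False
  obtain k where "1 \<le> k" "p \<in> hsphere n k" using assms by (auto simp: topspace_hawaiian)
  then show ?thesis
    using that[of k "sphere_to_cube n p"] False
    by (simp add: cube_to_sphere_to_cube sphere_to_cube_in_icube)
qed

text \<open>The gluing criterion for the earring. Away from \<open>theta\<close> a sphere is open
  and F factors through the inverse of its cell map. At \<open>theta\<close>, almost all spheres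
  stay in \<open>W\<close>, and a compact set is cut out of each of the remaining ones.\<close>

lemma continuous_map_prod_hawaiian:
  assumes n: "1 \<le> n" and Z: "compact_space Z"
    and base: "\<And>s. s \<in> topspace Z \<Longrightarrow> F (s, theta) = y"
    and cont: "\<And>k. 1 \<le> k \<Longrightarrow>
      continuous_map (prod_topology Z (cube_top n)) Y (\<lambda>(s, t). F (s, cube_to_sphere n k t))"
    and null: "\<And>W. openin Y W \<Longrightarrow> y \<in> W \<Longrightarrow>
      finite {k. 1 \<le> k \<and> \<not> (\<forall>s\<in>topspace Z. \<forall>t\<in>icube n. F (s, cube_to_sphere n k t) \<in> W)}"
  shows "continuous_map (prod_topology Z (hawaiian n)) Y F"
  unfolding continuous_map_def
proof (intro conjI allI impI)
  show "F \<in> topspace (prod_topology Z (hawaiian n)) \<rightarrow> topspace Y"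
  proof
    fix z assume "z \<in> topspace (prod_topology Z (hawaiian n))"
    then obtain s p where z: "z = (s, p)" "s \<in> topspace Z" "p \<in> topspace (hawaiian n)" by auto
    obtain k t where kt: "1 \<le> k" "t \<in> icube n" "p = cube_to_sphere n k t"
      using hawaiian_cell[OF z(3) n] .
    then show "F z \<in> topspace Y"
      using funcset_mem[OF continuous_map_funspace[OF cont[OF kt(1)]], of "(s, t)"] z by simp
  qed
next
  fix W assume W: "openin Y W"
  let ?P = "{z \<in> topspace (prod_topology Z (hawaiian n)). F z \<in> W}"
  show "openin (prod_topology Z (hawaiian n)) ?P"
  proof (subst openin_subopen, intro ballI)
    fix z assume zP: "z \<in> ?P"
    then obtain s p where z: "z = (s, p)" "s \<in> topspace Z" "p \<in> topspace (hawaiian n)" by auto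
    show "\<exists>T. openin (prod_topology Z (hawaiian n)) T \<and> z \<in> T \<and> T \<subseteq> ?P"
    proof (cases "p = theta")
      case False
      obtain k where k: "1 \<le> k" "p \<in> hsphere n k" using z by (auto simp: topspace_hawaiian)
      let ?O = "hsphere n k - {theta}"
      have OH: "?O \<subseteq> topspace (hawaiian n)" using k by (auto simp: topspace_hawaiian)
      have sO: "subtopology (hawaiian n) ?O = top_of_set ?O"
      proof -
        have "(\<Union>k\<in>{1..}. hsphere n k) \<inter> ?O = ?O" using OH by (auto simp: topspace_hawaiian)
        then show ?thesis by (simp add: hawaiian_eq subtopology_subtopology)
      qed
      have "continuous_on ?O (sphere_to_cube n)"
        by (rule continuous_on_subset[OF continuous_on_sphere_to_cube]) (use k in auto)
      then have "continuous_map (subtopology (hawaiian n) ?O) (cube_top n) (sphere_to_cube n)"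
        unfolding sO cube_top_eq by (auto simp: sphere_to_cube_in_icube)
      then have "continuous_map (prod_topology Z (subtopology (hawaiian n) ?O)) (prod_topology Z (cube_top n))
          (\<lambda>(s, p). (s, sphere_to_cube n p))"
        by (subst continuous_map_prod_top) simp
      then have "continuous_map (prod_topology Z (subtopology (hawaiian n) ?O)) Y
          ((\<lambda>(s, t). F (s, cube_to_sphere n k t)) \<circ> (\<lambda>(s, p). (s, sphere_to_cube n p)))"
        by (rule continuous_map_compose[OF _ cont[OF k(1)]])
      then have "continuous_map (prod_topology Z (subtopology (hawaiian n) ?O)) Y F"
      proof (rule continuous_map_eq)
        fix z assume "z \<in> topspace (prod_topology Z (subtopology (hawaiian n) ?O))"
        then obtain a b where "z = (a, b)" "b \<in> hsphere n k" "b \<noteq> theta" by auto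
        then show "((\<lambda>(s, t). F (s, cube_to_sphere n k t)) \<circ> (\<lambda>(s, p). (s, sphere_to_cube n p))) z = F z"
          by (simp add: cube_to_sphere_to_cube[OF _ _ k(1)])
      qed
      then have "openin (prod_topology Z (subtopology (hawaiian n) ?O))
          {z \<in> topspace (prod_topology Z (subtopology (hawaiian n) ?O)). F z \<in> W}" (is "openin _ ?T")
        using W by (rule openin_continuous_map_preimage)
      moreover have "openin (prod_topology Z (hawaiian n)) (topspace Z \<times> ?O)"
        by (simp add: openin_prod_Times_iff openin_sphere_minus[OF k(1)])
      ultimately have "openin (prod_topology Z (hawaiian n)) ?T"
        unfolding prod_topology_subtopology(2) by (rule openin_trans_full)
      moreover have "z \<in> ?T" using z k False zP by auto
      moreover have "?T \<subseteq> ?P" by auto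
      ultimately show ?thesis by blast
    next
      case True
      then have yW: "y \<in> W" using z zP base by auto
      \<comment> \<open>\<open>good k\<close> collects the cube points whose whole track stays in
        \<open>W\<close> and is open by the tube lemma. The removed set \<open>C\<close> is a finite
        union of compact images, and misses \<open>theta\<close> since
        \<open>y \<in> W\<close>.\<close>
      define good where "good k = {t \<in> topspace (cube_top n).
        \<forall>s\<in>topspace Z. (\<lambda>(s, t). F (s, cube_to_sphere n k t)) (s, t) \<in> W}" for k
      define bad where "bad = {k. 1 \<le> k \<and> \<not> (\<forall>s\<in>topspace Z. \<forall>t\<in>icube n. F (s, cube_to_sphere n k t) \<in> W)}"
      define C where "C = (\<Union>k\<in>bad. cube_to_sphere n k ` (icube n - good k))"
      have "closed (cube_to_sphere n k ` (icube n - good k))" if "1 \<le> k" for k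
      proof -
        have "openin (cube_top n) (good k)"
          unfolding good_def by (rule openin_tube[OF Z cont[OF that] W])
        then have "closedin (top_of_set (icube n)) (icube n - good k)"
          by (simp add: cube_top_eq closedin_diff)
        then have "compact (icube n - good k)" using compact_icube closedin_compact by blast
        moreover have "continuous_on (icube n - good k) (cube_to_sphere n k)"
          using continuous_on_cube_to_sphere[OF that] by (rule continuous_on_subset) auto
        ultimately show ?thesis by (intro compact_imp_closed compact_continuous_image)
      qed
      moreover have "finite bad" unfolding bad_def by (rule null[OF W yW])
      ultimately have "closed C" unfolding C_def by (intro closed_UN) (auto simp: bad_def)
      then have "openin (hawaiian n) (topspace (hawaiian n) - C)" (is "openin _ ?T")
        by (auto simp: hawaiian_eq openin_open intro!: exI[of _ "- C"])
      then have "openin (prod_topology Z (hawaiian n)) (topspace Z \<times> ?T)"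
        by (simp add: openin_prod_Times_iff)
      moreover have "theta \<notin> C"
      proof
        assume "theta \<in> C"
        then obtain k t where kt: "k \<in> bad" "t \<in> icube n - good k" "theta = cube_to_sphere n k t"
          by (auto simp: C_def)
        then have "t \<in> good k" using base yW by (simp add: good_def)
        then show False using kt by simp
      qed
      moreover have "topspace Z \<times> ?T \<subseteq> ?P"
      proof
        fix w assume "w \<in> topspace Z \<times> ?T"
        then obtain s p where w: "w = (s, p)" "s \<in> topspace Z" "p \<in> topspace (hawaiian n)" "p \<notin> C"
          by auto
        obtain k t where kt: "1 \<le> k" "t \<in> icube n" "p = cube_to_sphere n k t"
          using hawaiian_cell[OF w(3) n] .
        have "F (s, p) \<in> W"
        proof (cases "k \<in> bad")
          case True
          then have "t \<in> good k" using w(4) kt by (auto simp: C_def)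
          then show ?thesis using w kt by (simp add: good_def)
        next
          case False
          then show ?thesis using w kt by (simp add: bad_def)
        qed
        then show "w \<in> ?P" using w by simp
      qed
      ultimately show ?thesis using z True by (intro exI[of _ "topspace Z \<times> ?T"]) auto
    qed
  qed
qed

section \<open>Cells of the infinite Hawaiian earring\<close>

definition hinf_cell :: "nat \<Rightarrow> nat \<Rightarrow> (nat \<Rightarrow> real) \<Rightarrow> (nat \<times> (nat \<Rightarrow> real)) option" where
  "hinf_cell i k t = wj_inj (\<lambda>_. theta) i (cube_to_sphere (Suc i) k t)"

lemma hinf_cell_boundary [simp]: "t \<in> cube_boundary (Suc i) \<Longrightarrow> hinf_cell i k t = None"
  by (simp add: hinf_cell_def cube_to_sphere_boundary wj_inj_def)

lemma continuous_map_hinf_cell: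
  assumes "1 \<le> k"
  shows "continuous_map (cube_top (Suc i)) hinf (hinf_cell i k)"
proof -
  have "continuous_map (hawaiian (Suc i)) hinf (wj_inj (\<lambda>_. theta) i)"
    using continuous_map_wj_inj[of "\<lambda>i. hawaiian (Suc i)" i "\<lambda>_. theta"] by (simp add: hinf_def)
  from continuous_map_compose[OF continuous_map_cube_to_sphere[OF assms] this]
  show ?thesis by (simp add: o_def hinf_cell_def[abs_def])
qed

lemma hinf_cell_cases:
  assumes "q \<in> topspace hinf"
  obtains i k t where "1 \<le> k" "t \<in> icube (Suc i)" "q = hinf_cell i k t"
proof -
  have "\<exists>i p. p \<in> topspace (hawaiian (Suc i)) \<and> q = wj_inj (\<lambda>_. theta) i p"
  proof (cases q)
    case None
    have "theta \<in> topspace (hawaiian (Suc 0))" by (auto simp: topspace_hawaiian)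
    then show ?thesis using None by (metis wj_inj_def)
  next
    case (Some a)
    then show ?thesis using assms by (auto simp: hinf_def topspace_weak_join wj_carrier_def wj_inj_def)
  qed
  then obtain i p where p: "p \<in> topspace (hawaiian (Suc i))" "q = wj_inj (\<lambda>_. theta) i p" by blast
  obtain k t where "1 \<le> k" "t \<in> icube (Suc i)" "p = cube_to_sphere (Suc i) k t"
    using hawaiian_cell[OF p(1)] by auto
  then show ?thesis using that p(2) by (simp add: hinf_cell_def)
qed

text \<open>Both gluing criteria combined. Finiteness of the set of bad pairs serves twice: its
  projection to k handles each earring, and its projection to i handles the weak join.\<close>

lemma continuous_map_prod_hinf:
  assumes Z: "compact_space Z"
    and base: "\<And>s. s \<in> topspace Z \<Longrightarrow> F (s, None) = y" and y: "y \<in> topspace Y"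
    and cont: "\<And>i k. 1 \<le> k \<Longrightarrow>
      continuous_map (prod_topology Z (cube_top (Suc i))) Y (\<lambda>(s, t). F (s, hinf_cell i k t))"
    and null: "\<And>W. openin Y W \<Longrightarrow> y \<in> W \<Longrightarrow>
      finite {(i, k). 1 \<le> k \<and> \<not> (\<forall>s\<in>topspace Z. \<forall>t\<in>icube (Suc i). F (s, hinf_cell i k t) \<in> W)}"
  shows "continuous_map (prod_topology Z hinf) Y F"
  unfolding hinf_def
proof (rule continuous_map_prod_weak_join)
  show "compact_space Z" "y \<in> topspace Y" by fact+
  show "F (s, None) = y" if "s \<in> topspace Z" for s using that by (rule base)
next
  fix i
  show "continuous_map (prod_topology Z (hawaiian (Suc i))) Y (\<lambda>(s, p). F (s, wj_inj (\<lambda>_. theta) i p))"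
  proof (rule continuous_map_prod_hawaiian[OF _ Z])
    show "(\<lambda>(s, p). F (s, wj_inj (\<lambda>_. theta) i p)) (s, theta) = y" if "s \<in> topspace Z" for s
      using base[OF that] by (simp add: wj_inj_def)
    show "continuous_map (prod_topology Z (cube_top (Suc i))) Y
        (\<lambda>(s, t). (\<lambda>(s, p). F (s, wj_inj (\<lambda>_. theta) i p)) (s, cube_to_sphere (Suc i) k t))"
      if "1 \<le> k" for k
      using cont[OF that, of i] by (simp add: hinf_cell_def)
    fix W assume "openin Y W" "y \<in> W"
    from finite_imageI[OF null[OF this], of snd]
    show "finite {k. 1 \<le> k \<and> \<not> (\<forall>s\<in>topspace Z. \<forall>t\<in>icube (Suc i).
        (\<lambda>(s, p). F (s, wj_inj (\<lambda>_. theta) i p)) (s, cube_to_sphere (Suc i) k t) \<in> W)}"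
      by (rule rev_finite_subset) (force simp: hinf_cell_def)
  qed simp
next
  fix W assume "openin Y W" "y \<in> W"
  from finite_imageI[OF null[OF this], of fst]
  show "finite {i. \<not> (\<forall>s\<in>topspace Z. \<forall>p\<in>topspace (hawaiian (Suc i)). F (s, wj_inj (\<lambda>_. theta) i p) \<in> W)}"
  proof (rule rev_finite_subset, intro subsetI)
    fix i assume "i \<in> {i. \<not> (\<forall>s\<in>topspace Z. \<forall>p\<in>topspace (hawaiian (Suc i)). F (s, wj_inj (\<lambda>_. theta) i p) \<in> W)}"
    then obtain s p where sp: "s \<in> topspace Z" "p \<in> topspace (hawaiian (Suc i))"
      "F (s, wj_inj (\<lambda>_. theta) i p) \<notin> W" by auto
    obtain k t where "1 \<le> k" "t \<in> icube (Suc i)" "p = cube_to_sphere (Suc i) k t"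
      using hawaiian_cell[OF sp(2)] by auto
    with sp have "(i, k) \<in> {(i, k). 1 \<le> k \<and> \<not> (\<forall>s\<in>topspace Z. \<forall>t\<in>icube (Suc i). F (s, hinf_cell i k t) \<in> W)}"
      by (auto simp: hinf_cell_def)
    then show "i \<in> fst ` {(i, k). 1 \<le> k \<and> \<not> (\<forall>s\<in>topspace Z. \<forall>t\<in>icube (Suc i). F (s, hinf_cell i k t) \<in> W)}"
      by (rule image_eqI[rotated]) simp
  qed
qed

text \<open>The preimage of \<open>W\<close> contains all but finitely many earrings whole, and in
  each of the exceptional ones all but finitely many spheres.\<close>

lemma finite_large_cells:
  assumes f: "continuous_map hinf Y f" and W: "openin Y W" "f None \<in> W"
  shows "finite {(i, k). 1 \<le> k \<and> \<not> f ` hinf_cell i k ` icube (Suc i) \<subseteq> W}"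
proof -
  define V where "V = {q \<in> topspace hinf. f q \<in> W}"
  have None: "None \<in> topspace hinf" by (simp add: hinf_def topspace_weak_join wj_carrier_def)
  have V: "wj_open (\<lambda>i. hawaiian (Suc i)) (\<lambda>_. theta) V"
    using openin_continuous_map_preimage[OF f W(1)] by (simp add: V_def hinf_def openin_weak_join)
  let ?B = "{i. \<not> (wj_inj (\<lambda>_. theta) i ` topspace (hawaiian (Suc i)) \<subseteq> V)}"
  let ?S = "\<lambda>i. {p \<in> topspace (hawaiian (Suc i)). wj_inj (\<lambda>_. theta) i p \<in> V}"
  let ?K = "\<lambda>i. {k. 1 \<le> k \<and> \<not> hsphere (Suc i) k \<subseteq> ?S i}"
  have "finite ?B" using V W None by (simp add: wj_open_def V_def)
  moreover have "finite (?K i)" for i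
  proof (rule eventually_hsphere_subset)
    show "openin (hawaiian (Suc i)) (?S i)" using V by (simp add: wj_open_def)
    show "theta \<in> ?S i" using W None by (auto simp: V_def wj_inj_def topspace_hawaiian)
  qed
  ultimately have "finite (Sigma ?B ?K)" by (rule finite_SigmaI)
  then show ?thesis
  proof (rule rev_finite_subset, intro subsetI)
    fix j assume "j \<in> {(i, k). 1 \<le> k \<and> \<not> f ` hinf_cell i k ` icube (Suc i) \<subseteq> W}"
    then obtain i k t where j: "j = (i, k)" "1 \<le> k" "t \<in> icube (Suc i)" "f (hinf_cell i k t) \<notin> W" by auto
    let ?p = "cube_to_sphere (Suc i) k t"
    have "?p \<in> hsphere (Suc i) k" "?p \<in> topspace (hawaiian (Suc i))"
      using j(2) cube_to_sphere_in[OF j(2), of "Suc i" t] by (auto simp: topspace_hawaiian)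
    moreover have "wj_inj (\<lambda>_. theta) i ?p \<notin> V" using j by (simp add: V_def hinf_cell_def)
    ultimately show "j \<in> Sigma ?B ?K" using j by auto
  qed
qed

section \<open>Concatenation\<close>

text \<open>The last two facts serve the seam \<open>t 0 = 1/2\<close>, which the two rescalings
  send to the opposite faces \<open>t 0 = 1\<close> and \<open>t 0 = 0\<close>.\<close>

lemma icube_rescale:
  assumes "t \<in> icube n" "1 \<le> n"
  shows "t 0 \<le> 1/2 \<Longrightarrow> t(0 := 2 * t 0) \<in> icube n"
    and "1/2 \<le> t 0 \<Longrightarrow> t(0 := 2 * t 0 - 1) \<in> icube n"
    and "t \<in> cube_boundary n \<Longrightarrow> t 0 \<le> 1/2 \<Longrightarrow> t(0 := 2 * t 0) \<in> cube_boundary n"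
    and "t \<in> cube_boundary n \<Longrightarrow> 1/2 < t 0 \<Longrightarrow> t(0 := 2 * t 0 - 1) \<in> cube_boundary n"
    and "t(0 := 0) \<in> cube_boundary n" "t(0 := 1) \<in> cube_boundary n"
proof -
  show 1: "t 0 \<le> 1/2 \<Longrightarrow> t(0 := 2 * t 0) \<in> icube n"
    and 2: "1/2 \<le> t 0 \<Longrightarrow> t(0 := 2 * t 0 - 1) \<in> icube n"
    using assms by (auto simp: icube_def)
  show "t(0 := 2 * t 0) \<in> cube_boundary n" if bd: "t \<in> cube_boundary n" "t 0 \<le> 1/2"
  proof -
    obtain i where i: "i < n" "t i = 0 \<or> t i = 1" using bd(1) unfolding cube_boundary_def by blast
    then have "(t(0 := 2 * t 0)) i = 0 \<or> (t(0 := 2 * t 0)) i = 1" using bd(2) by (cases "i = 0") auto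
    moreover have "t(0 := 2 * t 0) \<in> icube n" using bd by (intro 1) auto
    ultimately show ?thesis using i(1) unfolding cube_boundary_def by blast
  qed
  show "t(0 := 2 * t 0 - 1) \<in> cube_boundary n" if bd: "t \<in> cube_boundary n" "1/2 < t 0"
  proof -
    obtain i where i: "i < n" "t i = 0 \<or> t i = 1" using bd(1) unfolding cube_boundary_def by blast
    then have "(t(0 := 2 * t 0 - 1)) i = 0 \<or> (t(0 := 2 * t 0 - 1)) i = 1" using bd(2) by (cases "i = 0") auto
    moreover have "t(0 := 2 * t 0 - 1) \<in> icube n" using bd by (intro 2) auto
    ultimately show ?thesis using i(1) unfolding cube_boundary_def by blast
  qed
  show "t(0 := 0) \<in> cube_boundary n" "t(0 := 1) \<in> cube_boundary n"
    using assms by (auto simp: cube_boundary_def icube_def intro!: exI[of _ 0])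
qed

text \<open>The parameter space \<open>Z\<close> lets one statement cover single maps and
  homotopies. On the seam both halves take the boundary value y, so they agree there.\<close>

lemma continuous_map_cube_concat:
  assumes n: "1 \<le> n"
    and F: "continuous_map (prod_topology Z (cube_top n)) Y F"
    and G: "continuous_map (prod_topology Z (cube_top n)) Y G"
    and bd: "\<And>s t. s \<in> topspace Z \<Longrightarrow> t \<in> cube_boundary n \<Longrightarrow> F (s, t) = y"
      "\<And>s t. s \<in> topspace Z \<Longrightarrow> t \<in> cube_boundary n \<Longrightarrow> G (s, t) = y"
  shows "continuous_map (prod_topology Z (cube_top n)) Y
    (\<lambda>(s, t). cube_concat (\<lambda>t. F (s, t)) (\<lambda>t. G (s, t)) t)"
proof -
  let ?X = "prod_topology Z (cube_top n)"
  have coord: "continuous_map (cube_top n) euclideanreal (\<lambda>t. t 0)"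
    by (simp add: cube_top_eq continuous_on_coordinate)
  have t0: "continuous_map ?X euclideanreal (\<lambda>z. snd z 0)"
    using continuous_map_compose[OF continuous_map_snd coord, of Z] by (simp add: o_def)
  have rescale: "continuous_map (subtopology ?X S) ?X (\<lambda>z. (fst z, h (snd z)))"
    if S: "\<And>z. z \<in> topspace ?X \<Longrightarrow> z \<in> S \<Longrightarrow> h (snd z) \<in> icube n"
      and h: "continuous_on (icube n) h" for S and h :: "(nat \<Rightarrow> real) \<Rightarrow> nat \<Rightarrow> real"
  proof (rule continuous_map_pairedI)
    show "continuous_map (subtopology ?X S) Z fst"
      by (simp add: continuous_map_from_subtopology continuous_map_fst)
    have "continuous_map (cube_top n) euclidean h" using h by (simp add: cube_top_eq)
    from continuous_map_compose[OF continuous_map_snd this, of Z]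
    have "continuous_map (subtopology ?X S) euclidean (\<lambda>z. h (snd z))"
      by (simp add: o_def continuous_map_from_subtopology)
    then show "continuous_map (subtopology ?X S) (cube_top n) (\<lambda>z. h (snd z))"
      using S unfolding cube_top_eq by (auto simp: continuous_map_in_subtopology)
  qed
  have upd: "continuous_on (icube n) (\<lambda>t. t(0 := 2 * t 0 - c))" for c
  proof (rule continuous_on_coordinatewise_then_product)
    fix i show "continuous_on (icube n) (\<lambda>t. (t(0 := 2 * t 0 - c)) i)"
      by (cases "i = 0") (auto intro!: continuous_intros)
  qed
  have "continuous_map ?X Y (\<lambda>z. if snd z 0 \<le> 1/2 then F (fst z, (snd z)(0 := 2 * snd z 0))
      else G (fst z, (snd z)(0 := 2 * snd z 0 - 1)))"
  proof (rule continuous_map_cases_le[OF t0])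
    show "continuous_map ?X euclideanreal (\<lambda>z. 1/2)" by simp
    have "continuous_map (subtopology ?X {z \<in> topspace ?X. snd z 0 \<le> 1/2}) ?X
       (\<lambda>z. (fst z, (snd z)(0 := 2 * snd z 0 - 0)))"
      by (rule rescale[OF _ upd]) (use icube_rescale(1)[OF _ n] in auto)
    from continuous_map_compose[OF this F]
    show "continuous_map (subtopology ?X {z \<in> topspace ?X. snd z 0 \<le> 1/2}) Y
       (\<lambda>z. F (fst z, (snd z)(0 := 2 * snd z 0)))"
      by (simp add: o_def)
    have "continuous_map (subtopology ?X {z \<in> topspace ?X. 1/2 \<le> snd z 0}) ?X
       (\<lambda>z. (fst z, (snd z)(0 := 2 * snd z 0 - 1)))"
      by (rule rescale[OF _ upd]) (use icube_rescale(2)[OF _ n] in auto)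
    from continuous_map_compose[OF this G]
    show "continuous_map (subtopology ?X {z \<in> topspace ?X. 1/2 \<le> snd z 0}) Y
       (\<lambda>z. G (fst z, (snd z)(0 := 2 * snd z 0 - 1)))"
      by (simp add: o_def)
    fix z assume z: "z \<in> topspace ?X" "snd z 0 = 1/2"
    then have "2 * snd z 0 = 1" "fst z \<in> topspace Z" "snd z \<in> icube n" by auto
    then show "F (fst z, (snd z)(0 := 2 * snd z 0)) = G (fst z, (snd z)(0 := 2 * snd z 0 - 1))"
      using icube_rescale(5,6)[OF _ n, of "snd z"] by (simp add: bd)
  qed
  then show ?thesis
    by (simp add: cube_concat_def case_prod_beta')
qed

lemma cube_concat_boundary:
  assumes "1 \<le> n" "\<And>t. t \<in> cube_boundary n \<Longrightarrow> f t = y" "\<And>t. t \<in> cube_boundary n \<Longrightarrow> g t = y"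
    and t: "t \<in> cube_boundary n"
  shows "cube_concat f g t = y"
  using icube_rescale(3,4)[OF subsetD[OF cube_boundary_subset t] assms(1) t] assms(2,3)
  by (auto simp: cube_concat_def)

lemma homotopic_cube_concat:
  assumes n: "1 \<le> n"
    and f: "homotopic_with (\<lambda>h. \<forall>t\<in>cube_boundary n. h t = y) (cube_top n) Y f f'"
    and g: "homotopic_with (\<lambda>h. \<forall>t\<in>cube_boundary n. h t = y) (cube_top n) Y g g'"
  shows "homotopic_with (\<lambda>h. \<forall>t\<in>cube_boundary n. h t = y) (cube_top n) Y
    (cube_concat f g) (cube_concat f' g')"
proof -
  let ?I = "top_of_set {0..1::real}"
  obtain F where F: "continuous_map (prod_topology ?I (cube_top n)) Y F"
    "\<And>t. F (0, t) = f t" "\<And>t. F (1, t) = f' t"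
    "\<And>s t. s \<in> {0..1} \<Longrightarrow> t \<in> cube_boundary n \<Longrightarrow> F (s, t) = y"
    using f unfolding homotopic_with_def by blast
  obtain G where G: "continuous_map (prod_topology ?I (cube_top n)) Y G"
    "\<And>t. G (0, t) = g t" "\<And>t. G (1, t) = g' t"
    "\<And>s t. s \<in> {0..1} \<Longrightarrow> t \<in> cube_boundary n \<Longrightarrow> G (s, t) = y"
    using g unfolding homotopic_with_def by blast
  let ?H = "\<lambda>(s, t). cube_concat (\<lambda>t. F (s, t)) (\<lambda>t. G (s, t)) t"
  have "continuous_map (prod_topology ?I (cube_top n)) Y ?H"
    by (rule continuous_map_cube_concat[OF n F(1) G(1)]) (auto simp: F G)
  moreover have "\<forall>s\<in>{0..1}. \<forall>t\<in>cube_boundary n. ?H (s, t) = y"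
    using cube_concat_boundary[OF n, of "\<lambda>t. F (_, t)" y "\<lambda>t. G (_, t)"] F(4) G(4) by simp
  ultimately show ?thesis
    unfolding homotopic_with_def by (intro exI[of _ ?H]) (simp add: F G)
qed

text \<open>In the open cube \<open>SOME k\<close> returns the given index, because spheres meet
  only at \<open>theta\<close>, and \<open>sphere_to_cube\<close> undoes the cell map. On the
  boundary both sides equal y.\<close>

lemma hinf_concat_cell:
  assumes t: "t \<in> icube (Suc i)" and k: "1 \<le> k" and fg: "f None = y" "g None = y"
  shows "hinf_concat f g (hinf_cell i k t) = cube_concat (f \<circ> hinf_cell i k) (g \<circ> hinf_cell i k) t"
proof (cases "t \<in> cube_boundary (Suc i)")
  case True
  then have "cube_concat (f \<circ> hinf_cell i k) (g \<circ> hinf_cell i k) t = y"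
    by (intro cube_concat_boundary[of "Suc i"]) (auto simp: fg)
  then show ?thesis using True fg by (simp add: hinf_concat_def)
next
  case False
  then have int: "\<forall>j<Suc i. 0 < t j \<and> t j < 1" using icube_boundary_iff[OF t] by simp
  let ?p = "cube_to_sphere (Suc i) k t"
  have p: "?p \<noteq> theta" by (rule cube_to_sphere_neq_theta[OF int k])
  have "(SOME k. 1 \<le> k \<and> ?p \<in> hsphere (Suc i) k) = k"
    by (rule some_equality) (use k p cube_to_sphere_in[OF k] hsphere_unique in blast)+
  moreover have "sphere_to_cube (Suc i) ?p = t"
    by (rule sphere_to_cube_to_sphere[OF t int k])
  moreover have "hinf_cell i k t = Some (i, ?p)" using p by (simp add: hinf_cell_def wj_inj_def)
  ultimately show ?thesis
    by (simp add: hinf_concat_def sphere_concat_def cube_concat_def hinf_cell_def Let_def)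
qed

lemma continuous_map_hinf_concat:
  assumes f: "continuous_map hinf Y f" "f None = y" and g: "continuous_map hinf Y g" "g None = y"
  shows "continuous_map hinf Y (hinf_concat f g)"
proof -
  \<comment> \<open>A one-point parameter space turns the gluing criterion for homotopies into one
    for single maps.\<close>
  let ?Z = "top_of_set {0::real}"
  have "continuous_map (prod_topology ?Z hinf) Y (\<lambda>(s, q). hinf_concat f g q)"
  proof (rule continuous_map_prod_hinf)
    show "compact_space ?Z" by (simp add: compact_space_subtopology)
    show "(\<lambda>(s, q). hinf_concat f g q) (s, None) = y" for s by (simp add: hinf_concat_def f)
    show "y \<in> topspace Y"
      using f continuous_map_funspace[OF f(1)] by (auto simp: hinf_def topspace_weak_join wj_carrier_def)
  next
    fix i k :: nat assume k: "1 \<le> k"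
    let ?c = "\<lambda>f :: (nat \<times> (nat \<Rightarrow> real)) option \<Rightarrow> 'a. f \<circ> hinf_cell i k"
    have *: "continuous_map (prod_topology ?Z (cube_top (Suc i))) Y (?c h \<circ> snd)"
      if "continuous_map hinf Y h" for h
      using continuous_map_compose[OF continuous_map_compose[OF continuous_map_snd continuous_map_hinf_cell[OF k]] that]
      by (simp add: o_assoc)
    have "continuous_map (prod_topology ?Z (cube_top (Suc i))) Y
       (\<lambda>(s, t). cube_concat (\<lambda>t. (?c f \<circ> snd) (s, t)) (\<lambda>t. (?c g \<circ> snd) (s, t)) t)"
      by (rule continuous_map_cube_concat[OF _ *[OF f(1)] *[OF g(1)]]) (auto simp: f g)
    then show "continuous_map (prod_topology ?Z (cube_top (Suc i))) Y
        (\<lambda>(s, t). (\<lambda>(s, q). hinf_concat f g q) (s, hinf_cell i k t))"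
      by (rule continuous_map_eq) (auto simp: hinf_concat_cell[where y = y] k[simplified] f(2) g(2) o_def)
  next
    fix W assume W: "openin Y W" "y \<in> W"
    have "finite ({(i, k). 1 \<le> k \<and> \<not> f ` hinf_cell i k ` icube (Suc i) \<subseteq> W} \<union>
        {(i, k). 1 \<le> k \<and> \<not> g ` hinf_cell i k ` icube (Suc i) \<subseteq> W})"
      using finite_large_cells[OF f(1) W(1)] finite_large_cells[OF g(1) W(1)] W f g by simp
    then show "finite {(i, k). 1 \<le> k \<and> \<not> (\<forall>s\<in>topspace ?Z. \<forall>t\<in>icube (Suc i).
        (\<lambda>(s, q). hinf_concat f g q) (s, hinf_cell i k t) \<in> W)}"
    proof (rule rev_finite_subset, intro subsetI)
      fix j assume "j \<in> {(i, k). 1 \<le> k \<and> \<not> (\<forall>s\<in>topspace ?Z. \<forall>t\<in>icube (Suc i).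
        (\<lambda>(s, q). hinf_concat f g q) (s, hinf_cell i k t) \<in> W)}"
      then obtain i k t where j: "j = (i, k)" "1 \<le> k" "t \<in> icube (Suc i)"
        "cube_concat (f \<circ> hinf_cell i k) (g \<circ> hinf_cell i k) t \<notin> W"
        by (auto simp: hinf_concat_cell[where y = y] f(2) g(2))
      \<comment> \<open>Every value of the concatenation on a cell is a value of f or of g on the
        same cell, so a bad cell is already bad for one of them.\<close>
      then have "\<exists>t\<in>icube (Suc i). f (hinf_cell i k t) \<notin> W \<or> g (hinf_cell i k t) \<notin> W"
      proof (cases "t 0 \<le> 1/2")
        case True
        then show ?thesis
          using j(4) icube_rescale(1)[OF j(3)] by (intro bexI[of _ "t(0 := 2 * t 0)"]) (auto simp: cube_concat_def)
      next
        case False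
        then show ?thesis
          using j(4) icube_rescale(2)[OF j(3)] by (intro bexI[of _ "t(0 := 2 * t 0 - 1)"]) (auto simp: cube_concat_def)
      qed
      then show "j \<in> {(i, k). 1 \<le> k \<and> \<not> f ` hinf_cell i k ` icube (Suc i) \<subseteq> W} \<union>
        {(i, k). 1 \<le> k \<and> \<not> g ` hinf_cell i k ` icube (Suc i) \<subseteq> W}"
        using j by auto
    qed
  qed
  then have "continuous_map hinf Y ((\<lambda>(s, q). hinf_concat f g q) \<circ> (\<lambda>q. (0::real, q)))"
    by (rule continuous_map_compose[rotated]) (intro continuous_map_pairedI, auto)
  then show ?thesis by (simp add: o_def)
qed

section \<open>Small homotopies in the weak join\<close>

text \<open>First countability supplies neighbourhoods \<open>U m\<close> that shrink to the base
  point, and local contractibility supplies a \<open>V m\<close> that contracts inside each of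
  them.\<close>

lemma local_contraction_sequence:
  assumes x: "x \<in> topspace X" and lsc: "loc_strong_contractible_at X x" and fc: "first_countable_at X x"
  obtains V U :: "nat \<Rightarrow> 'a set" where
    "\<And>m. openin X (V m)" "\<And>m. x \<in> V m"
    "\<And>m. homotopic_with (\<lambda>h. h x = x) (subtopology X (V m)) (subtopology X (U m)) id (\<lambda>_. x)"
    "\<And>W. openin X W \<Longrightarrow> x \<in> W \<Longrightarrow> \<exists>M. \<forall>m\<ge>M. U m \<subseteq> W"
proof -
  obtain B where "countable B" "\<forall>V\<in>B. openin X V \<and> x \<in> V"
    "\<forall>U. openin X U \<and> x \<in> U \<longrightarrow> (\<exists>V\<in>B. V \<subseteq> U)"
    using fc unfolding first_countable_at_def by (elim exE conjE)
  then have B: "countable B" "\<And>V. V \<in> B \<Longrightarrow> openin X V \<and> x \<in> V"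
    "\<And>U. openin X U \<Longrightarrow> x \<in> U \<Longrightarrow> \<exists>V\<in>B. V \<subseteq> U"
    by simp_all
  have "B \<noteq> {}" using B(3)[OF openin_topspace x] by auto
  then have rb: "range (from_nat_into B) = B" using B(1) by (simp add: range_from_nat_into)
  \<comment> \<open>Finite intersections make the enumerated base decreasing, so containment in
    \<open>W\<close> persists from some index on.\<close>
  define U where "U m = (\<Inter>j\<in>{..m}. from_nat_into B j)" for m :: nat
  have "openin X (from_nat_into B j) \<and> x \<in> from_nat_into B j" for j
    using B(2) rb by blast
  then have U: "openin X (U m)" "x \<in> U m" for m
    unfolding U_def by (auto intro!: openin_INT)
  then have "is_nbhd X x (U m)" for m
    unfolding is_nbhd_def using openin_subset by blast
  then have "\<exists>V. openin X V \<and> x \<in> V \<and>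
      homotopic_with (\<lambda>h. h x = x) (subtopology X V) (subtopology X (U m)) id (\<lambda>_. x)" for m
  proof -
    obtain V' where V': "is_nbhd X x V'"
      "homotopic_with (\<lambda>h. h x = x) (subtopology X V') (subtopology X (U m)) id (\<lambda>_. x)"
      using lsc \<open>is_nbhd X x (U m)\<close> unfolding loc_strong_contractible_at_def by blast
    then obtain V where V: "openin X V" "x \<in> V" "V \<subseteq> V'" unfolding is_nbhd_def by blast
    \<comment> \<open>The contractible neighbourhood is replaced by an open one inside it, to which
      the contraction restricts.\<close>
    then have "V' \<inter> V = V" by blast
    with homotopic_from_subtopology[OF V'(2), of V] V show ?thesis
      by (auto simp: subtopology_subtopology)
  qed
  then obtain V where V: "\<And>m. openin X (V m)" "\<And>m. x \<in> V m"
    "\<And>m. homotopic_with (\<lambda>h. h x = x) (subtopology X (V m)) (subtopology X (U m)) id (\<lambda>_. x)"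
    by metis
  have "\<exists>M. \<forall>m\<ge>M. U m \<subseteq> W" if W: "openin X W" "x \<in> W" for W
  proof -
    obtain M where "from_nat_into B M \<subseteq> W" using B(3)[OF W] rb by (metis imageE)
    then show ?thesis by (intro exI[of _ M]) (auto simp: U_def)
  qed
  then show ?thesis using that V by blast
qed

text \<open>Only finitely many summands constrain membership in \<open>W\<close>, and in each of
  them \<open>U i m\<close> eventually lies in the trace of \<open>W\<close>.\<close>

lemma wj_nbhd_small:
  assumes small: "\<And>i W. openin (X i) W \<Longrightarrow> x i \<in> W \<Longrightarrow> \<exists>M. \<forall>m\<ge>M. U i m \<subseteq> W"
    and x: "\<And>i. x i \<in> topspace (X i)"
    and W: "openin (weak_join X x) W" "None \<in> W"
  shows "\<exists>M. \<forall>m\<ge>M. wj_nbhd X x m (\<lambda>i. U i m) \<subseteq> W"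
proof -
  define I where "I = {i. \<not> (wj_inj x i ` topspace (X i) \<subseteq> W)}"
  have I: "finite I" using W by (simp add: I_def openin_weak_join wj_open_def)
  have "\<exists>M. \<forall>m\<ge>M. U i m \<subseteq> {p \<in> topspace (X i). wj_inj x i p \<in> W}" for i
    using W x by (intro small) (auto simp: openin_weak_join wj_open_def)
  then obtain M where M: "\<And>i m. m \<ge> M i \<Longrightarrow> U i m \<subseteq> {p \<in> topspace (X i). wj_inj x i p \<in> W}"
    by metis
  \<comment> \<open>For \<open>m \<ge> N\<close> every exceptional index satisfies both
    \<open>i < m\<close>, so that \<open>wj_nbhd\<close> restricts that summand, and
    \<open>M i \<le> m\<close>, so that the restriction is small enough.\<close>
  define N where "N = (\<Sum>i\<in>I. Suc i + M i)"
  have N: "Suc i + M i \<le> N" if "i \<in> I" for i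
    unfolding N_def using that I by (intro member_le_sum) auto
  have "wj_nbhd X x m (\<lambda>i. U i m) \<subseteq> W" if m: "m \<ge> N" for m
  proof
    fix q assume q: "q \<in> wj_nbhd X x m (\<lambda>i. U i m)"
    then have "q \<in> wj_carrier X x" by (simp add: wj_nbhd_def)
    then show "q \<in> W"
    proof (cases rule: wj_carrier_cases)
      case 1 then show ?thesis using W by simp
    next
      case (2 i p)
      show ?thesis
      proof (cases "i \<in> I")
        case True
        then have "i < m" "M i \<le> m" using N[of i] m by auto
        then have "p \<in> U i m" using q 2(3) by (simp add: wj_nbhd_def)
        then have "wj_inj x i p \<in> W" using M[OF \<open>M i \<le> m\<close>] by auto
        then show ?thesis using 2(4) by simp
      next
        case False
        then have "wj_inj x i p \<in> W" using 2(1) unfolding I_def by blast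
        then show ?thesis using 2(4) by simp
      qed
    qed
  qed
  then show ?thesis by blast
qed

text \<open>Truncating the given, possibly large, homotopy in \<open>X\<close> makes it small, and the truncated
  end maps are joined to \<open>f\<close> and \<open>g\<close> by small homotopies.\<close>
lemma homotopic_in_wj_nbhd:
  assumes x: "\<And>i. i < m \<Longrightarrow> x i \<in> A i"
    and contr: "\<And>i. i < m \<Longrightarrow> homotopic_with (\<lambda>h. h (x i) = x i)
        (subtopology (X i) (A i)) (subtopology (X i) (B i)) id (\<lambda>_. x i)"
    and fg: "homotopic_with (\<lambda>h. \<forall>t\<in>S. h t = None) C (weak_join X x) f g"
    and f: "f ` topspace C \<subseteq> wj_nbhd X x m A" and g: "g ` topspace C \<subseteq> wj_nbhd X x m A"
  shows "homotopic_with (\<lambda>h. \<forall>t\<in>S. h t = None) C (subtopology (weak_join X x) (wj_nbhd X x m B)) f g"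
proof -
  let ?P = "\<lambda>h. \<forall>t\<in>S. h t = None"
  let ?B = "subtopology (weak_join X x) (wj_nbhd X x m B)"
  \<comment> \<open>A map into the neighbourhood built from \<open>A\<close> is joined to its
    truncation by the contractions; the homotopy is relative to \<open>S\<close> because they fix
    the common point.\<close>
  have *: "homotopic_with ?P C ?B h (wj_truncate m \<circ> h)"
    if h: "h ` topspace C \<subseteq> wj_nbhd X x m A" "continuous_map C (weak_join X x) h" "?P h" for h
  proof -
    have "continuous_map C (subtopology (weak_join X x) (wj_nbhd X x m A)) h"
      using h by (auto simp: continuous_map_in_subtopology)
    from homotopic_with_compose_continuous_map_right[OF homotopic_wj_truncate[OF x contr] this]
    show ?thesis using h(3) by (auto simp: o_def)
  qed
  have "homotopic_with ?P C ?B (wj_truncate m \<circ> f) (wj_truncate m \<circ> g)"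
    by (rule homotopic_with_compose_continuous_map_left[OF fg continuous_map_wj_truncate]) simp
  then show ?thesis
    using *[OF f] *[OF g] homotopic_with_imp_continuous_maps[OF fg] homotopic_with_imp_property[OF fg]
    by (meson homotopic_with_trans homotopic_with_symD)
qed

text \<open>The cell homotopies are replaced by ones inside neighbourhoods of the common point whose
  index tends to infinity along the cells; these satisfy the smallness condition of the gluing
  criterion.\<close>

lemma homotopic_hinfI:
  assumes x: "\<And>i. x i \<in> topspace (X i)"
    and lsc: "\<And>i. loc_strong_contractible_at (X i) (x i)"
    and fc: "\<And>i. first_countable_at (X i) (x i)"
    and f: "continuous_map hinf (weak_join X x) f" "f None = None"
    and g: "continuous_map hinf (weak_join X x) g" "g None = None"
    and cells: "\<And>i k. 1 \<le> k \<Longrightarrow> homotopic_with (\<lambda>h. \<forall>t\<in>cube_boundary (Suc i). h t = None)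
      (cube_top (Suc i)) (weak_join X x) (f \<circ> hinf_cell i k) (g \<circ> hinf_cell i k)"
  shows "homotopic_with (\<lambda>h. h None = None) hinf (weak_join X x) f g"
proof -
  let ?Y = "weak_join X x"
  let ?I = "top_of_set {0..1::real}"
  have "\<exists>V U. (\<forall>m::nat. openin (X i) (V m)) \<and> (\<forall>m. x i \<in> V m) \<and>
    (\<forall>m. homotopic_with (\<lambda>h. h (x i) = x i) (subtopology (X i) (V m)) (subtopology (X i) (U m)) id (\<lambda>_. x i)) \<and>
    (\<forall>W. openin (X i) W \<longrightarrow> x i \<in> W \<longrightarrow> (\<exists>M. \<forall>m\<ge>M. U m \<subseteq> W))" for i
    by (rule local_contraction_sequence[OF x lsc fc, of i]) blast
  then obtain V U where V: "\<And>i m. openin (X i) (V i m)" "\<And>i m. x i \<in> V i m"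
    and contr: "\<And>i m. homotopic_with (\<lambda>h. h (x i) = x i) (subtopology (X i) (V i m)) (subtopology (X i) (U i m)) id (\<lambda>_. x i)"
    and small: "\<And>i W. openin (X i) W \<Longrightarrow> x i \<in> W \<Longrightarrow> \<exists>M::nat. \<forall>m\<ge>M. U i m \<subseteq> W"
    by metis
  define VV where "VV m = wj_nbhd X x m (\<lambda>i. V i m)" for m
  define UU where "UU m = wj_nbhd X x m (\<lambda>i. U i m)" for m
  have VV: "openin ?Y (VV m)" "None \<in> VV m" for m
    using V by (simp_all add: VV_def openin_weak_join wj_open_wj_nbhd)
  define fits where "fits m i k \<longleftrightarrow> f ` hinf_cell i k ` icube (Suc i) \<subseteq> VV m \<and> g ` hinf_cell i k ` icube (Suc i) \<subseteq> VV m"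
    for m i k
  \<comment> \<open>The largest index whose neighbourhood holds the cell images of both f and g. The
    cap \<open>i + k\<close> makes the maximum exist even for a cell sent to the common point, which
    fits every m, and itself grows along the cells.\<close>
  define \<mu> where "\<mu> i k = Max {m. m \<le> i + k \<and> fits m i k}" for i k
  have im: "f ` hinf_cell i k ` icube (Suc i) \<subseteq> topspace ?Y" "g ` hinf_cell i k ` icube (Suc i) \<subseteq> topspace ?Y"
    if "1 \<le> k" for i k
    using continuous_map_image_subset_topspace[OF continuous_map_compose[OF continuous_map_hinf_cell[OF that] f(1)], of i]
      continuous_map_image_subset_topspace[OF continuous_map_compose[OF continuous_map_hinf_cell[OF that] g(1)], of i]
    by (simp_all add: image_comp)
  \<comment> \<open>With \<open>m = 0\<close> no summand is restricted, so the maximum is taken over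
    a nonempty set.\<close>
  have "VV 0 = topspace ?Y" by (auto simp: VV_def wj_nbhd_def topspace_weak_join)
  then have "fits 0 i k" if "1 \<le> k" for i k using im[OF that, of i] by (simp add: fits_def)
  then have ne: "0 \<in> {m. m \<le> i + k \<and> fits m i k}" if "1 \<le> k" for i k using that by simp
  have fin: "finite {m. m \<le> i + k \<and> fits m i k}" for i k by simp
  have \<mu>: "fits (\<mu> i k) i k" if "1 \<le> k" for i k
    using Max_in[OF fin[of i k]] ne[OF that, of i] unfolding \<mu>_def by blast
  \<comment> \<open>An index below \<open>M\<close> means that the cap is below \<open>M\<close> or
    that one of the two cells leaves \<open>VV M\<close>. Each happens for only finitely many
    cells.\<close>
  have \<mu>_large: "finite {(i, k). 1 \<le> k \<and> \<mu> i k < M}" for M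
  proof -
    have "finite ({..<M} \<times> {..<M} \<union> ({(i, k). 1 \<le> k \<and> \<not> f ` hinf_cell i k ` icube (Suc i) \<subseteq> VV M} \<union>
        {(i, k). 1 \<le> k \<and> \<not> g ` hinf_cell i k ` icube (Suc i) \<subseteq> VV M}))"
      using finite_large_cells[OF f(1) VV(1)] finite_large_cells[OF g(1) VV(1)] VV(2) f g by simp
    then show ?thesis
    proof (rule rev_finite_subset, intro subsetI)
      fix j assume "j \<in> {(i, k). 1 \<le> k \<and> \<mu> i k < M}"
      then obtain i k where j: "j = (i, k)" "1 \<le> k" "\<mu> i k < M" by auto
      have "i + k < M \<or> \<not> fits M i k"
      proof (rule ccontr)
        assume "\<not> (i + k < M \<or> \<not> fits M i k)"
        then have "M \<le> \<mu> i k" unfolding \<mu>_def by (intro Max_ge fin) auto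
        then show False using j by simp
      qed
      then show "j \<in> {..<M} \<times> {..<M} \<union> ({(i, k). 1 \<le> k \<and> \<not> f ` hinf_cell i k ` icube (Suc i) \<subseteq> VV M} \<union>
        {(i, k). 1 \<le> k \<and> \<not> g ` hinf_cell i k ` icube (Suc i) \<subseteq> VV M})"
        using j by (auto simp: fits_def)
    qed
  qed
  have small_cells: "homotopic_with (\<lambda>h. \<forall>t\<in>cube_boundary (Suc i). h t = None) (cube_top (Suc i))
      (subtopology ?Y (UU (\<mu> i k))) (f \<circ> hinf_cell i k) (g \<circ> hinf_cell i k)" if "1 \<le> k" for i k
    unfolding UU_def
    by (rule homotopic_in_wj_nbhd[OF V(2) contr cells[OF that]])
      (use \<mu>[OF that, of i] in \<open>auto simp: fits_def VV_def image_comp\<close>)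
  define Q where "Q i k h \<longleftrightarrow>
      continuous_map (prod_topology ?I (cube_top (Suc i))) (subtopology ?Y (UU (\<mu> i k))) h \<and>
      (\<forall>t. h (0, t) = f (hinf_cell i k t)) \<and> (\<forall>t. h (1, t) = g (hinf_cell i k t)) \<and>
      (\<forall>s\<in>{0..1}. \<forall>t\<in>cube_boundary (Suc i). h (s, t) = None)" for i k h
  have Q_ex: "\<exists>h. Q i k h" if "1 \<le> k" for i k
  proof -
    from small_cells[OF that, of i] obtain h
      where "continuous_map (prod_topology ?I (cube_top (Suc i))) (subtopology ?Y (UU (\<mu> i k))) h"
        "\<forall>t. h (0, t) = (f \<circ> hinf_cell i k) t" "\<forall>t. h (1, t) = (g \<circ> hinf_cell i k) t"
        "\<forall>s\<in>{0..1}. \<forall>t\<in>cube_boundary (Suc i). h (s, t) = None"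
      unfolding homotopic_with_def by blast
    then show ?thesis by (intro exI[of _ h]) (simp add: Q_def)
  qed
  define H where "H i k = (SOME h. Q i k h)" for i k
  have Q: "Q i k (H i k)" if "1 \<le> k" for i k
    unfolding H_def using Q_ex[OF that] by (rule someI_ex)
  have H: "continuous_map (prod_topology ?I (cube_top (Suc i))) (subtopology ?Y (UU (\<mu> i k))) (H i k)"
    "H i k (0, t) = f (hinf_cell i k t)" "H i k (1, t) = g (hinf_cell i k t)"
    "s \<in> {0..1} \<Longrightarrow> t \<in> cube_boundary (Suc i) \<Longrightarrow> H i k (s, t) = None"
    if "1 \<le> k" for i k s t
    using Q[OF that, of i] unfolding Q_def by blast+
  \<comment> \<open>The cell homotopies are assembled through the inverses of the cell maps.
    \<open>SOME k\<close> is unambiguous because a point other than \<open>theta\<close> lies on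
    only one sphere.\<close>
  define F where "F = (\<lambda>(s, q). case q of None \<Rightarrow> None | Some (i, p) \<Rightarrow>
    H i (SOME k. 1 \<le> k \<and> p \<in> hsphere (Suc i) k) (s, sphere_to_cube (Suc i) p))"
  have F: "F (s, hinf_cell i k t) = H i k (s, t)" if k: "1 \<le> k" and st: "s \<in> {0..1}" "t \<in> icube (Suc i)" for s i k t
  proof (cases "t \<in> cube_boundary (Suc i)")
    case True
    then show ?thesis using H(4)[OF k st(1)] by (simp add: F_def)
  next
    case False
    then have int: "\<forall>j<Suc i. 0 < t j \<and> t j < 1" using icube_boundary_iff[OF st(2)] by simp
    let ?p = "cube_to_sphere (Suc i) k t"
    have p: "?p \<noteq> theta" by (rule cube_to_sphere_neq_theta[OF int k])
    have "(SOME k. 1 \<le> k \<and> ?p \<in> hsphere (Suc i) k) = k"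
      by (rule some_equality) (use k p cube_to_sphere_in[OF k] hsphere_unique in blast)+
    moreover have "sphere_to_cube (Suc i) ?p = t"
      by (rule sphere_to_cube_to_sphere[OF st(2) int k])
    moreover have "hinf_cell i k t = Some (i, ?p)" using p by (simp add: hinf_cell_def wj_inj_def)
    ultimately show ?thesis by (simp add: F_def)
  qed
  have "continuous_map (prod_topology ?I hinf) ?Y F"
  proof (rule continuous_map_prod_hinf)
    show "compact_space ?I" by (simp add: compact_space_subtopology)
    show "F (s, None) = None" for s by (simp add: F_def)
    show "None \<in> topspace ?Y" by (simp add: topspace_weak_join wj_carrier_def)
    fix i k :: nat assume k: "1 \<le> k"
    have "continuous_map (prod_topology ?I (cube_top (Suc i))) ?Y (H i k)"
      using H(1)[OF k] by (simp add: continuous_map_in_subtopology)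
    then show "continuous_map (prod_topology ?I (cube_top (Suc i))) ?Y (\<lambda>(s, t). F (s, hinf_cell i k t))"
    proof (rule continuous_map_eq)
      fix z assume "z \<in> topspace (prod_topology ?I (cube_top (Suc i)))"
      then obtain s t where z: "z = (s, t)" "s \<in> {0..1}" "t \<in> icube (Suc i)" by auto
      show "H i k z = (\<lambda>(s, t). F (s, hinf_cell i k t)) z" using F[OF k z(2,3)] z(1) by simp
    qed
  next
    fix W assume W: "openin ?Y W" "None \<in> W"
    \<comment> \<open>Once \<open>\<mu> i k \<ge> M\<close>, the whole homotopy on that cell stays
      in \<open>W\<close>. Only the finitely many cells with smaller index can leave it.\<close>
    have "\<exists>M. \<forall>m\<ge>M. UU m \<subseteq> W"
      unfolding UU_def using small x W by (rule wj_nbhd_small)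
    then obtain M where M: "\<And>m. m \<ge> M \<Longrightarrow> UU m \<subseteq> W" by blast
    show "finite {(i, k). 1 \<le> k \<and> \<not> (\<forall>s\<in>topspace ?I. \<forall>t\<in>icube (Suc i). F (s, hinf_cell i k t) \<in> W)}"
    proof (rule rev_finite_subset[OF \<mu>_large[of M]], intro subsetI)
      fix j assume "j \<in> {(i, k). 1 \<le> k \<and> \<not> (\<forall>s\<in>topspace ?I. \<forall>t\<in>icube (Suc i). F (s, hinf_cell i k t) \<in> W)}"
      then obtain i k s t where j: "j = (i, k)" "1 \<le> k" "s \<in> {0..1}" "t \<in> icube (Suc i)"
        "F (s, hinf_cell i k t) \<notin> W" by auto
      have "H i k (s, t) \<in> UU (\<mu> i k)"
        using funcset_mem[OF continuous_map_funspace[OF H(1)[OF j(2)]], of "(s, t)"] j by simp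
      then have "\<mu> i k < M" using M[of "\<mu> i k"] j(5) F[OF j(2-4)] by force
      then show "j \<in> {(i, k). 1 \<le> k \<and> \<mu> i k < M}" using j by simp
    qed
  qed
  moreover have "F (0, q) = f q" "F (1, q) = g q" if q0: "q \<in> topspace hinf" for q
  proof -
    obtain i k t where q: "1 \<le> k" "t \<in> icube (Suc i)" "q = hinf_cell i k t"
      using hinf_cell_cases[OF q0] .
    show "F (0, q) = f q" using F[OF q(1) _ q(2), of 0] H(2)[OF q(1), of i t] q(3) by simp
    show "F (1, q) = g q" using F[OF q(1) _ q(2), of 1] H(3)[OF q(1), of i t] q(3) by simp
  qed
  moreover have "F (s, None) = None" for s by (simp add: F_def)
  moreover have "None \<in> topspace hinf" by (simp add: hinf_def topspace_weak_join wj_carrier_def)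
  ultimately have "\<exists>h. continuous_map (prod_topology ?I hinf) ?Y h \<and> (\<forall>q\<in>topspace hinf. h (0, q) = f q) \<and>
      (\<forall>q\<in>topspace hinf. h (1, q) = g q) \<and> (\<forall>s\<in>{0..1}. h (s, None) = None)"
    by blast
  \<comment> \<open>F has the right ends only on \<open>topspace hinf\<close>. This suffices since
    the condition on the maps concerns their value at \<open>None\<close>, a point of that
    space.\<close>
  with \<open>None \<in> topspace hinf\<close> show ?thesis
    by (subst homotopic_with) metis+
qed

section \<open>The embedding\<close>

lemma pi_class_eqI:
  assumes "homotopic_with (\<lambda>h. \<forall>t\<in>cube_boundary n. h t = y) (cube_top n) Y f g"
  shows "pi_class n Y y f = pi_class n Y y g"
  unfolding pi_class_def
  using homotopic_with_trans[OF assms] homotopic_with_trans[OF homotopic_with_symD[OF assms]] by blast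

lemma hinf_class_eqI:
  assumes "homotopic_with (\<lambda>h. h None = y) hinf Y f g"
  shows "hinf_class Y y f = hinf_class Y y g"
  unfolding hinf_class_def
  using homotopic_with_trans[OF assms] homotopic_with_trans[OF homotopic_with_symD[OF assms]] by blast

lemma homotopic_hinf_cell:
  assumes "homotopic_with (\<lambda>h. h None = y) hinf Y f g" "1 \<le> k"
  shows "homotopic_with (\<lambda>h. \<forall>t\<in>cube_boundary (Suc i). h t = y) (cube_top (Suc i)) Y
    (f \<circ> hinf_cell i k) (g \<circ> hinf_cell i k)"
  by (rule homotopic_with_compose_continuous_map_right[OF assms(1) continuous_map_hinf_cell[OF assms(2)]]) simp

text \<open>Multiplication of classes picks representatives by \<open>SOME\<close>; this fact ties
  the pick back to f.\<close>

lemma some_in_hinf_class: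
  assumes "continuous_map hinf Y f" "f None = y"
  shows "homotopic_with (\<lambda>h. h None = y) hinf Y f (SOME g. g \<in> hinf_class Y y f)"
proof -
  have "f \<in> hinf_class Y y f" using assms by (simp add: hinf_class_def)
  then show ?thesis using someI[of "\<lambda>g. g \<in> hinf_class Y y f" f] by (simp add: hinf_class_def)
qed

lemma some_in_pi_class:
  assumes "continuous_map (cube_top n) Y f" "\<forall>t\<in>cube_boundary n. f t = y"
  shows "homotopic_with (\<lambda>h. \<forall>t\<in>cube_boundary n. h t = y) (cube_top n) Y f (SOME g. g \<in> pi_class n Y y f)"
proof -
  have "f \<in> pi_class n Y y f" using assms by (simp add: pi_class_def)
  then show ?thesis using someI[of "\<lambda>g. g \<in> pi_class n Y y f" f] by (simp add: pi_class_def)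
qed

text \<open>The \<open>restrict\<close> form is the extensionality that carriers of
  \<open>product_group\<close> demand. Cells of dimension n carry the index
  \<open>n - 1\<close>.\<close>

definition cell_classes :: "'b topology \<Rightarrow> 'b \<Rightarrow> ((nat \<times> (nat \<Rightarrow> real)) option \<Rightarrow> 'b) set \<Rightarrow>
    nat \<Rightarrow> nat \<Rightarrow> ((nat \<Rightarrow> real) \<Rightarrow> 'b) set" where
  "cell_classes Y y A = (\<lambda>n\<in>{n. 1 \<le> n}. \<lambda>k\<in>{k. 1 \<le> k}.
     pi_class n Y y ((SOME f. f \<in> A) \<circ> hinf_cell (n - 1) k))"

text \<open>A homotopy between representatives restricts to every cell, so the family does not
  depend on the one picked by \<open>SOME\<close>.\<close>

lemma cell_classes_hinf_class:
  assumes "continuous_map hinf Y f" "f None = y"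
  shows "cell_classes Y y (hinf_class Y y f) =
    (\<lambda>n\<in>{n. 1 \<le> n}. \<lambda>k\<in>{k. 1 \<le> k}. pi_class n Y y (f \<circ> hinf_cell (n - 1) k))"
  unfolding cell_classes_def
proof (intro restrict_ext)
  fix n k :: nat assume "n \<in> {n. 1 \<le> n}" "k \<in> {k. 1 \<le> k}"
  then show "pi_class n Y y ((SOME g. g \<in> hinf_class Y y f) \<circ> hinf_cell (n - 1) k) =
      pi_class n Y y (f \<circ> hinf_cell (n - 1) k)"
    using pi_class_eqI[OF homotopic_hinf_cell[OF some_in_hinf_class[OF assms], of k "n - 1"]] by simp
qed

text \<open>On each cell \<open>hinf_concat\<close> is \<open>cube_concat\<close> on the nose; what
  remains is to reconcile the representatives chosen by \<open>SOME\<close> on the two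
  sides.\<close>

lemma cell_classes_hom:
  "cell_classes Y y \<in> hom (Hinf_group Y y)
     (product_group {n. 1 \<le> n} (\<lambda>n. product_group {k. 1 \<le> k} (\<lambda>k. pi_group n Y y)))"
  unfolding hom_def
proof (intro CollectI conjI ballI)
  have cell: "continuous_map (cube_top n) Y (f \<circ> hinf_cell (n - 1) k)"
    "\<forall>t\<in>cube_boundary n. (f \<circ> hinf_cell (n - 1) k) t = y"
    if "continuous_map hinf Y f" "f None = y" "1 \<le> n" "1 \<le> k" for f n k
    using continuous_map_compose[OF continuous_map_hinf_cell[OF that(4), of "n - 1"] that(1)] that
      hinf_cell_boundary[of _ "n - 1" k] by auto
  show "cell_classes Y y \<in> carrier (Hinf_group Y y) \<rightarrow>
    carrier (product_group {n. 1 \<le> n} (\<lambda>n. product_group {k. 1 \<le> k} (\<lambda>k. pi_group n Y y)))"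
  proof
    fix A assume "A \<in> carrier (Hinf_group Y y)"
    then obtain f where f: "continuous_map hinf Y f" "f None = y" "A = hinf_class Y y f"
      by (auto simp: Hinf_group_def)
    then show "cell_classes Y y A \<in>
      carrier (product_group {n. 1 \<le> n} (\<lambda>n. product_group {k. 1 \<le> k} (\<lambda>k. pi_group n Y y)))"
      using cell[OF f(1,2)] by (auto simp: cell_classes_hinf_class pi_group_def intro!: imageI)
  qed
  fix A B assume "A \<in> carrier (Hinf_group Y y)" "B \<in> carrier (Hinf_group Y y)"
  then obtain f0 g0 where fg0: "continuous_map hinf Y f0" "f0 None = y" "A = hinf_class Y y f0"
    "continuous_map hinf Y g0" "g0 None = y" "B = hinf_class Y y g0"
    by (auto simp: Hinf_group_def)
  \<comment> \<open>These are the very representatives that the product in \<open>Hinf_group\<close>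
    picks, so \<open>AB\<close> holds by unfolding.\<close>
  define f where "f = (SOME f. f \<in> A)"
  define g where "g = (SOME g. g \<in> B)"
  have hf: "homotopic_with (\<lambda>h. h None = y) hinf Y f0 f" and hg: "homotopic_with (\<lambda>h. h None = y) hinf Y g0 g"
    unfolding f_def g_def fg0(3,6) by (rule some_in_hinf_class[OF fg0(1,2)] some_in_hinf_class[OF fg0(4,5)])+
  have f: "continuous_map hinf Y f" "f None = y" "A = hinf_class Y y f"
    using homotopic_with_imp_continuous_maps[OF hf] homotopic_with_imp_property[OF hf] hinf_class_eqI[OF hf] fg0(3)
    by auto
  have g: "continuous_map hinf Y g" "g None = y" "B = hinf_class Y y g"
    using homotopic_with_imp_continuous_maps[OF hg] homotopic_with_imp_property[OF hg] hinf_class_eqI[OF hg] fg0(6)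
    by auto
  have AB: "A \<otimes>\<^bsub>Hinf_group Y y\<^esub> B = hinf_class Y y (hinf_concat f g)"
    by (simp add: Hinf_group_def f_def g_def)
  have "hinf_concat f g None = y" by (simp add: hinf_concat_def f)
  then have lhs: "cell_classes Y y (A \<otimes>\<^bsub>Hinf_group Y y\<^esub> B) =
      (\<lambda>n\<in>{n. 1 \<le> n}. \<lambda>k\<in>{k. 1 \<le> k}. pi_class n Y y (hinf_concat f g \<circ> hinf_cell (n - 1) k))"
    unfolding AB by (rule cell_classes_hinf_class[OF continuous_map_hinf_concat[OF f(1,2) g(1,2)]])
  have eq: "pi_class n Y y (hinf_concat f g \<circ> hinf_cell (n - 1) k) =
      pi_class n Y y (f \<circ> hinf_cell (n - 1) k) \<otimes>\<^bsub>pi_group n Y y\<^esub> pi_class n Y y (g \<circ> hinf_cell (n - 1) k)"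
    if n: "1 \<le> n" and k: "1 \<le> k" for n k
  proof -
    let ?P = "\<lambda>h. \<forall>t\<in>cube_boundary n. h t = y"
    let ?f = "f \<circ> hinf_cell (n - 1) k" and ?g = "g \<circ> hinf_cell (n - 1) k"
    note cf = cell[OF f(1,2) n k] and cg = cell[OF g(1,2) n k]
    have "homotopic_with ?P (cube_top n) Y (cube_concat ?f ?g)
        (cube_concat (SOME u. u \<in> pi_class n Y y ?f) (SOME u. u \<in> pi_class n Y y ?g))"
      by (rule homotopic_cube_concat[OF n some_in_pi_class[OF cf] some_in_pi_class[OF cg]])
    \<comment> \<open>The two maps agree on the cube but perhaps not outside it. A reflexive
      homotopy, altered off the cube, replaces equality of functions.\<close>
    moreover have "homotopic_with ?P (cube_top n) Y (cube_concat ?f ?g) (cube_concat ?f ?g)"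
      by (rule homotopic_cube_concat[OF n]) (use cf cg in simp_all)
    then have "homotopic_with ?P (cube_top n) Y (hinf_concat f g \<circ> hinf_cell (n - 1) k) (cube_concat ?f ?g)"
    proof (rule homotopic_with_eq)
      fix t assume "t \<in> topspace (cube_top n)"
      then show "(hinf_concat f g \<circ> hinf_cell (n - 1) k) t = cube_concat ?f ?g t"
        using hinf_concat_cell[of t "n - 1" k f y g] n k f g by simp
    qed (use cube_boundary_subset in \<open>auto simp: subset_iff\<close>)
    ultimately have "pi_class n Y y (hinf_concat f g \<circ> hinf_cell (n - 1) k) =
      pi_class n Y y (cube_concat (SOME u. u \<in> pi_class n Y y ?f) (SOME u. u \<in> pi_class n Y y ?g))"
      by (intro pi_class_eqI) (rule homotopic_with_trans)
    then show ?thesis by (simp add: pi_group_def)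
  qed
  show "cell_classes Y y (A \<otimes>\<^bsub>Hinf_group Y y\<^esub> B) = cell_classes Y y A
      \<otimes>\<^bsub>product_group {n. 1 \<le> n} (\<lambda>n. product_group {k. 1 \<le> k} (\<lambda>k. pi_group n Y y))\<^esub> cell_classes Y y B"
    unfolding lhs unfolding f(3) g(3) cell_classes_hinf_class[OF f(1,2)] cell_classes_hinf_class[OF g(1,2)]
    by (auto simp: eq[unfolded One_nat_def] intro!: restrict_ext)
qed

theorem theorem3p9:
  fixes X :: "nat \<Rightarrow> 'a topology" and x :: "nat \<Rightarrow> 'a"
  assumes "\<And>i. x i \<in> topspace (X i)"
    and "\<And>i. loc_strong_contractible_at (X i) (x i)"
    and "\<And>i. first_countable_at (X i) (x i)"
  shows "\<exists>\<phi>. \<phi> \<in> hom (Hinf_group (weak_join X x) None)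
              (product_group {n::nat. 1 \<le> n}
                 (\<lambda>n. product_group {k::nat. 1 \<le> k} (\<lambda>k. pi_group n (weak_join X x) None)))
           \<and> inj_on \<phi> (carrier (Hinf_group (weak_join X x) None))"
proof (intro exI conjI)
  let ?Y = "weak_join X x"
  show "cell_classes ?Y None \<in> hom (Hinf_group ?Y None)
      (product_group {n. 1 \<le> n} (\<lambda>n. product_group {k. 1 \<le> k} (\<lambda>k. pi_group n ?Y None)))"
    by (rule cell_classes_hom)
  show "inj_on (cell_classes ?Y None) (carrier (Hinf_group ?Y None))"
  proof
    fix A B assume "A \<in> carrier (Hinf_group ?Y None)" "B \<in> carrier (Hinf_group ?Y None)"
      and eq: "cell_classes ?Y None A = cell_classes ?Y None B"
    then obtain f g where f: "continuous_map hinf ?Y f" "f None = None" "A = hinf_class ?Y None f"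
      and g: "continuous_map hinf ?Y g" "g None = None" "B = hinf_class ?Y None g"
      by (auto simp: Hinf_group_def)
    have "homotopic_with (\<lambda>h. \<forall>t\<in>cube_boundary (Suc i). h t = None) (cube_top (Suc i)) ?Y
        (f \<circ> hinf_cell i k) (g \<circ> hinf_cell i k)" if k: "1 \<le> k" for i k
    proof -
      \<comment> \<open>Coordinate \<open>(Suc i, k)\<close> of the equal families says that the two
        cell maps have the same class, hence are homotopic relative to the boundary.\<close>
      have "cell_classes ?Y None A (Suc i) k = cell_classes ?Y None B (Suc i) k" by (simp add: eq)
      then have "pi_class (Suc i) ?Y None (f \<circ> hinf_cell i k) = pi_class (Suc i) ?Y None (g \<circ> hinf_cell i k)"
        unfolding f(3) g(3) cell_classes_hinf_class[OF f(1,2)] cell_classes_hinf_class[OF g(1,2)]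
        using k by simp
      moreover have "g \<circ> hinf_cell i k \<in> pi_class (Suc i) ?Y None (g \<circ> hinf_cell i k)"
        using continuous_map_compose[OF continuous_map_hinf_cell[OF k] g(1)] g(2) by (simp add: pi_class_def)
      ultimately have "g \<circ> hinf_cell i k \<in> pi_class (Suc i) ?Y None (f \<circ> hinf_cell i k)" by simp
      then show ?thesis by (simp add: pi_class_def)
    qed
    from homotopic_hinfI[OF assms f(1,2) g(1,2) this]
    show "A = B" unfolding f(3) g(3) by (rule hinf_class_eqI)
  qed
qed

end
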